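(* Let $G=(V,E)$ be a (connected) Eulerian digraph, let $v_0$ be a vertex of $G$, and let $A$ be any totally unimodular matrix representing the oriented dual $M^*$ of the graphic matroid of $G$. Then the triangulation $$\{\Delta_B \mid E-B \text{ is a spanning arborescence of } G \text{ rooted at } v_0\}$$ of the root polytope $\mathcal{Q}_A$ of $M^*$ is a geometric embedding of the dual complex of the directed branching greedoid of $G$ rooted at $v_0$.
   Context: Digraphs are finite (multi)graphs with at least one edge; Eulerian digraphs are connected, and Eulerian means in-degree equals out-degree at every vertex. A tree in $G$ is a subgraph whose underlying undirected graph is connected and cycle-free. An arborescence rooted at $v_0$ is a tree $F$ containing $v_0$ in which every edge $e$ is oriented away from $v_0$ (its tail lies in the component of $F-e$ containing $v_0$). It is spanning if it contains all vertices. The directed branching greedoid of $G$ with root $v_0$ has ground set $E$, its accessible sets are the arborescences rooted at $v_0$, and its bases are the spanning arborescences rooted at $v_0$. Its dual complex is the abstract simplicial complex $\mathcal{S}$ of all $S\subseteq E$ such that $E\setminus S$ contains a basis; its maximal simplices are the complements of spanning arborescences rooted at $v_0$. A matrix is totally unimodular if all its subdeterminants are in $\{0,1,-1\}$. For a totally unimodular matrix $A$ with columns $(a_i)_{i\in E}$ in $\mathbb{Z}^n$, a circuit is a minimal $C\subseteq E$ with $\{a_i\}_{i\in C}$ linearly dependent (as a family). A signed circuit is a pair $(C^+,C^-)$ with $C=C^+\sqcup C^-$ a circuit for which there is a linear dependence $\sum_{i\in C}\lambda_i a_i=0$ with $\lambda_i>0$ on $C^+$ and $\lambda_i<0$ on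 $C^-$. A cut of $G$ is the set of all edges joining $V_1$ and $V_2$ for a partition $V=V_1\sqcup V_2$; an elementary cut is an inclusion-minimal nonempty cut; its signing consists of the set of its edges directed from $V_1$ to $V_2$ and the set of its edges directed from $V_2$ to $V_1$ (in either order). $A$ represents the oriented dual of the graphic matroid of $G$ if its columns are indexed by $E$ and its signed circuits are exactly the signed elementary cuts of $G$. The root polytope of $A$ is $\mathcal{Q}_A=\mathrm{Conv}\{a_i: i\in E\}$. For $S\subseteq E$ put $\Delta_S=\mathrm{Conv}\{a_i : i\in S\}$. A triangulation of a polytope $P$ is a family of simplices of dimension $\dim P$ with pairwise disjoint relative interiors whose union is $P$ and any two of which intersect in a common (possibly empty) face. That the triangulation is a geometric embedding of the abstract simplicial complex $\mathcal{S}$ means: for every $S\in\mathcal{S}$ the family $(a_i)_{i\in S}$ is affinely independent, so that $\Delta_S$ is a simplex of dimension $|S|-1$; for all $S,S'\in\mathcal{S}$ one has $\Delta_S\cap\Delta_{S'}=\Delta_{S\cap S'}$; and the simplices $\Delta_S$, $S\in\mathcal{S}$, are exactly the faces (including the empty one) of the simplices of the triangulation. *)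

theory Defs
  imports
    "HOL-Analysis.Analysis"
    "Graph_Theory.Digraph_Component"
    "Jordan_Normal_Form.Determinant"
begin

section \<open>Eulerian digraphs and arborescences\<close>

definition eulerian_digraph :: "('v, 'e) pre_digraph \<Rightarrow> bool" where
  "eulerian_digraph G \<longleftrightarrow>
     fin_digraph G \<and> arcs G \<noteq> {} \<and> Digraph_Component.connected G \<and>
     (\<forall>v\<in>verts G. in_degree G v = out_degree G v)"

text \<open>
  The library predicate \<^const>\<open>forest\<close> only excludes directed cycles, so it does not express that
  the underlying undirected multigraph is cycle-free.  Here the underlying undirected multigraph
  is encoded by giving every edge a forward and a backward copy; its cycles are the directed
  cycles of the doubled graph that use no edge twice (in particular not once in each direction).
  Loops and pairs of parallel or antiparallel edges are cycles.
\<close>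

definition both_directions :: "('v, 'e) pre_digraph \<Rightarrow> ('v, 'e \<times> bool) pre_digraph" where
  "both_directions G =
     \<lparr> verts = verts G, arcs = arcs G \<times> UNIV,
       tail = (\<lambda>(e, fwd). if fwd then tail G e else head G e),
       head = (\<lambda>(e, fwd). if fwd then head G e else tail G e) \<rparr>"

definition undirected_cycle :: "('v, 'e) pre_digraph \<Rightarrow> ('e \<times> bool) list \<Rightarrow> bool" where
  "undirected_cycle G p \<longleftrightarrow> pre_digraph.cycle (both_directions G) p \<and> distinct (map fst p)"

definition tree_in :: "('v, 'e) pre_digraph \<Rightarrow> ('v, 'e) pre_digraph \<Rightarrow> bool" where
  "tree_in G F \<longleftrightarrow> subgraph F G \<and> Digraph_Component.connected F \<and> (\<nexists>p. undirected_cycle F p)"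

definition arborescence_in :: "('v, 'e) pre_digraph \<Rightarrow> 'v \<Rightarrow> ('v, 'e) pre_digraph \<Rightarrow> bool" where
  "arborescence_in G v\<^sub>0 F \<longleftrightarrow>
     tree_in G F \<and> v\<^sub>0 \<in> verts F \<and>
     (\<forall>e\<in>arcs F. v\<^sub>0 \<rightarrow>\<^sup>*\<^bsub>with_proj (mk_symmetric (pre_digraph.del_arc F e))\<^esub> tail F e)"

definition spanning_arborescence_in ::
    "('v, 'e) pre_digraph \<Rightarrow> 'v \<Rightarrow> ('v, 'e) pre_digraph \<Rightarrow> bool" where
  "spanning_arborescence_in G v\<^sub>0 F \<longleftrightarrow> arborescence_in G v\<^sub>0 F \<and> spanning F G"

text \<open>
  Arborescences are subgraphs; the members of the directed branching greedoid are their edge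
  sets.
\<close>

definition branching_bases :: "('v, 'e) pre_digraph \<Rightarrow> 'v \<Rightarrow> 'e set set" where
  "branching_bases G v\<^sub>0 = {arcs F |F. spanning_arborescence_in G v\<^sub>0 F}"

definition branching_dual_complex :: "('v, 'e) pre_digraph \<Rightarrow> 'v \<Rightarrow> 'e set set" where
  "branching_dual_complex G v\<^sub>0 = {S. S \<subseteq> arcs G \<and> (\<exists>T\<in>branching_bases G v\<^sub>0. T \<subseteq> arcs G - S)}"


section \<open>Totally unimodular matrices and signed circuits\<close>

text \<open>
  A matrix with rows indexed by the finite type \<open>'n\<close> and columns indexed by a set \<open>E\<close> is a
  function \<open>A\<close>, with \<open>A i e\<close> the entry in row \<open>i\<close> and column \<open>e\<close>.  Rows and columns of a square
  submatrix may be listed in any order, which affects only the sign of its determinant.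
\<close>

definition totally_unimodular :: "('n \<Rightarrow> 'e \<Rightarrow> int) \<Rightarrow> 'e set \<Rightarrow> bool" where
  "totally_unimodular A E \<longleftrightarrow>
     (\<forall>k r c. inj_on r {..<k} \<and> inj_on c {..<k} \<and> c ` {..<k} \<subseteq> E \<longrightarrow>
        Determinant.det (Matrix.mat k k (\<lambda>(i, j). A (r i) (c j))) \<in> {0, 1, -1})"

definition real_column :: "('n::finite \<Rightarrow> 'e \<Rightarrow> int) \<Rightarrow> 'e \<Rightarrow> real ^ 'n" where
  "real_column A e = (\<chi> i. real_of_int (A i e))"

text \<open>
  Dependence of families: \<^const>\<open>dependent\<close> and \<^const>\<open>affine_dependent\<close> speak about sets of
  vectors, so a repeated vector is excluded separately.
\<close>

definition dependent_family :: "('e \<Rightarrow> 'a::real_vector) \<Rightarrow> 'e set \<Rightarrow> bool" where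
  "dependent_family a C \<longleftrightarrow> \<not> (inj_on a C \<and> independent (a ` C))"

definition affine_independent_family :: "('e \<Rightarrow> 'a::real_vector) \<Rightarrow> 'e set \<Rightarrow> bool" where
  "affine_independent_family a S \<longleftrightarrow> inj_on a S \<and> \<not> affine_dependent (a ` S)"

definition circuit :: "('e \<Rightarrow> 'a::real_vector) \<Rightarrow> 'e set \<Rightarrow> 'e set \<Rightarrow> bool" where
  "circuit a E C \<longleftrightarrow> C \<subseteq> E \<and> dependent_family a C \<and> (\<forall>D. D \<subset> C \<longrightarrow> \<not> dependent_family a D)"

definition signed_circuits :: "('e \<Rightarrow> 'a::real_vector) \<Rightarrow> 'e set \<Rightarrow> ('e set \<times> 'e set) set" where
  "signed_circuits a E =
     {(P, N). P \<inter> N = {} \<and> circuit a E (P \<union> N) \<and>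
        (\<exists>l :: 'e \<Rightarrow> real. (\<Sum>i\<in>P \<union> N. l i *\<^sub>R a i) = 0 \<and> (\<forall>i\<in>P. l i > 0) \<and> (\<forall>i\<in>N. l i < 0))}"


section \<open>Signed elementary cuts\<close>

definition directed_cut :: "('v, 'e) pre_digraph \<Rightarrow> 'v set \<Rightarrow> 'v set \<Rightarrow> 'e set" where
  "directed_cut G V1 V2 = {e \<in> arcs G. tail G e \<in> V1 \<and> head G e \<in> V2}"

definition vertex_partition :: "('v, 'e) pre_digraph \<Rightarrow> 'v set \<Rightarrow> 'v set \<Rightarrow> bool" where
  "vertex_partition G V1 V2 \<longleftrightarrow> V1 \<union> V2 = verts G \<and> V1 \<inter> V2 = {}"

definition cut :: "('v, 'e) pre_digraph \<Rightarrow> 'e set \<Rightarrow> bool" where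
  "cut G D \<longleftrightarrow>
     (\<exists>V1 V2. vertex_partition G V1 V2 \<and> D = directed_cut G V1 V2 \<union> directed_cut G V2 V1)"

definition elementary_cut :: "('v, 'e) pre_digraph \<Rightarrow> 'e set \<Rightarrow> bool" where
  "elementary_cut G D \<longleftrightarrow> cut G D \<and> D \<noteq> {} \<and> (\<forall>D'. cut G D' \<and> D' \<noteq> {} \<longrightarrow> \<not> D' \<subset> D)"

text \<open>Both orders of a signing occur, since \<open>V1\<close> and \<open>V2\<close> may be exchanged.\<close>

definition signed_elementary_cuts :: "('v, 'e) pre_digraph \<Rightarrow> ('e set \<times> 'e set) set" where
  "signed_elementary_cuts G =
     {(directed_cut G V1 V2, directed_cut G V2 V1) |V1 V2.
        vertex_partition G V1 V2 \<and> elementary_cut G (directed_cut G V1 V2 \<union> directed_cut G V2 V1)}"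

definition represents_oriented_dual ::
    "('n::finite \<Rightarrow> 'e \<Rightarrow> int) \<Rightarrow> ('v, 'e) pre_digraph \<Rightarrow> bool" where
  "represents_oriented_dual A G \<longleftrightarrow>
     signed_circuits (real_column A) (arcs G) = signed_elementary_cuts G"


section \<open>Root polytopes, triangulations and geometric embeddings\<close>

definition col_hull :: "('n::finite \<Rightarrow> 'e \<Rightarrow> int) \<Rightarrow> 'e set \<Rightarrow> (real ^ 'n) set" where
  "col_hull A S = convex hull (real_column A ` S)"

abbreviation root_polytope :: "('n::finite \<Rightarrow> 'e \<Rightarrow> int) \<Rightarrow> 'e set \<Rightarrow> (real ^ 'n) set" where
  "root_polytope A E \<equiv> col_hull A E"

text \<open>
  \<^const>\<open>triangulation\<close> says that the members are finitely many simplices, any two of which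
  intersect in a common face.
\<close>

definition triangulation_of :: "'a::euclidean_space set \<Rightarrow> 'a set set \<Rightarrow> bool" where
  "triangulation_of P \<T> \<longleftrightarrow>
     triangulation \<T> \<and> (\<forall>T\<in>\<T>. aff_dim T = aff_dim P) \<and>
     pairwise (\<lambda>T T'. rel_interior T \<inter> rel_interior T' = {}) \<T> \<and> \<Union>\<T> = P"

definition arborescence_simplices ::
    "('n::finite \<Rightarrow> 'e \<Rightarrow> int) \<Rightarrow> ('v, 'e) pre_digraph \<Rightarrow> 'v \<Rightarrow> (real ^ 'n) set set" where
  "arborescence_simplices A G v\<^sub>0 =
     {col_hull A B |B. B \<subseteq> arcs G \<and>
        (\<exists>F. spanning_arborescence_in G v\<^sub>0 F \<and> arcs F = arcs G - B)}"

definition geometric_embedding ::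
    "('n::finite \<Rightarrow> 'e \<Rightarrow> int) \<Rightarrow> 'e set set \<Rightarrow> (real ^ 'n) set set \<Rightarrow> bool" where
  "geometric_embedding A \<S> \<T> \<longleftrightarrow>
     (\<forall>S\<in>\<S>. affine_independent_family (real_column A) S) \<and>
     (\<forall>S\<in>\<S>. \<forall>S'\<in>\<S>. col_hull A S \<inter> col_hull A S' = col_hull A (S \<inter> S')) \<and>
     col_hull A ` \<S> = {K. \<exists>T\<in>\<T>. K face_of T}"

lemma geometric_embedding_simplex:
  assumes "geometric_embedding A \<S> \<T>" and "S \<in> \<S>"
  shows "(int (card S) - 1) simplex (col_hull A S)"
  using assms
  by (auto simp: geometric_embedding_def affine_independent_family_def col_hull_def card_image
      intro!: simplex_convex_hull)

end

theory Submission
  imports Defs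
begin

text \<open>
  Write \<open>a\<^sub>e\<close> for the column of the arc \<open>e\<close>, and for a potential \<open>\<phi>\<close> on the vertices let \<open>\<delta>\<phi>\<close> be its coboundary
  \<open>\<delta>\<phi> e = \<phi> (head e) - \<phi> (tail e)\<close>.  The linear relations between the columns are exactly the coboundaries
  (\<open>coboundary_relation\<close>, \<open>relation_is_coboundary\<close>).  Indeed, total unimodularity makes the relation on a circuit
  a multiple of a vector with entries \<open>1\<close> and \<open>-1\<close>; since the signed circuits are the signed elementary cuts, this
  is a cut vector, that is, the coboundary of an indicator function; and the elementary cut vectors span the cut
  space.

  Hence two coefficient vectors represent the same point if and only if they differ by a coboundary.  In an
  Eulerian digraph the values of a coboundary sum to zero, so they then have the same coefficient sum, and the
  barycentric representations of a point \<open>p\<close> of the root polytope are exactly the nonnegative vectors of the form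
  \<open>x + \<delta>\<phi>\<close>, where \<open>x\<close> is one of them.  Read \<open>x\<close> as a length function on the arcs.  Every vertex
  can be reached from the root, because a connected Eulerian digraph is strongly connected.  If \<open>- \<phi>\<close> is the
  distance from the root, then \<open>x + \<delta>\<phi>\<close> is nonnegative and vanishes on a spanning arborescence of shortest paths
  (\<open>extend_tight_arborescence\<close>).  Conversely, if two such vectors differ by the coboundary of a potential, then
  one arborescence shows that this potential is smallest at the root and the other that it is largest
  there, so it is constant (\<open>nonneg_tight_unique\<close>).

  Thus every point of the root polytope has exactly one barycentric representation whose support is a face of the
  dual complex (\<open>barycentric_unique\<close>, \<open>arborescence_simplices_cover\<close>).  Existence says that the simplices cover the
  polytope, and uniqueness that they meet in the simplices spanned by the common columns.  As each simplex spans
  the affine hull of the whole polytope (\<open>aff_dim_arborescence_simplex\<close>), they form a triangulation, and the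
  faces of its members correspond to the members of the dual complex.
\<close>

section \<open>Relations on circuits\<close>

lemma dependent_family_iff:
  fixes a :: "'e \<Rightarrow> 'a::real_vector"
  assumes fin: "finite C"
  shows "dependent_family a C \<longleftrightarrow> (\<exists>l. (\<Sum>i\<in>C. l i *\<^sub>R a i) = 0 \<and> (\<exists>i\<in>C. l i \<noteq> 0))"
proof
  assume dep: "dependent_family a C"
  show "\<exists>l. (\<Sum>i\<in>C. l i *\<^sub>R a i) = 0 \<and> (\<exists>i\<in>C. l i \<noteq> 0)"
  proof (cases "inj_on a C")
    case True
    then have "dependent (a ` C)" using dep by (simp add: dependent_family_def)
    then obtain u where u: "\<exists>v\<in>a ` C. u v \<noteq> 0" "(\<Sum>v\<in>a ` C. u v *\<^sub>R v) = 0"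
      using fin by (auto simp: real_vector.dependent_finite)
    have "(\<Sum>i\<in>C. u (a i) *\<^sub>R a i) = 0" using u(2) True by (simp add: sum.reindex)
    with u(1) show ?thesis by (intro exI[of _ "\<lambda>i. u (a i)"]) auto
  next
    case False
    then obtain i j where ij: "i \<in> C" "j \<in> C" "i \<noteq> j" "a i = a j" by (auto simp: inj_on_def)
    define l :: "'e \<Rightarrow> real" where "l k = (if k = i then 1 else if k = j then -1 else 0)" for k
    have "(\<Sum>k\<in>C. l k *\<^sub>R a k) = (\<Sum>k\<in>{i,j}. l k *\<^sub>R a k)"
      using ij fin by (intro sum.mono_neutral_right) (auto simp: l_def)
    also have "\<dots> = 0" using ij by (simp add: l_def)
    finally show ?thesis using ij by (intro exI[of _ l]) (auto simp: l_def)
  qed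
next
  assume "\<exists>l. (\<Sum>i\<in>C. l i *\<^sub>R a i) = 0 \<and> (\<exists>i\<in>C. l i \<noteq> 0)"
  then obtain l i where l: "(\<Sum>i\<in>C. l i *\<^sub>R a i) = 0" "i \<in> C" "l i \<noteq> 0" by blast
  show "dependent_family a C"
  proof (rule ccontr)
    assume "\<not> dependent_family a C"
    then have inj: "inj_on a C" and ind: "independent (a ` C)" by (auto simp: dependent_family_def)
    have "(\<Sum>v\<in>a ` C. l (inv_into C a v) *\<^sub>R v) = 0" using inj l(1) by (simp add: sum.reindex)
    then have "l (inv_into C a (a i)) = 0"
      using ind fin l(2) by (auto simp: real_vector.dependent_finite)
    then show False using inj l by simp
  qed
qed

lemma dependent_family_mono:
  fixes a :: "'e \<Rightarrow> 'a::real_vector"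
  assumes "dependent_family a D" "D \<subseteq> C"
  shows "dependent_family a C"
  using assms unfolding dependent_family_def
  by (meson image_mono inj_on_subset real_vector.independent_mono)

lemma circuit_in_dependent_family:
  fixes a :: "'e \<Rightarrow> 'a::real_vector"
  assumes "finite D" "D \<subseteq> E" "dependent_family a D"
  shows "\<exists>C\<subseteq>D. circuit a E C"
  using assms
proof (induction D rule: finite_psubset_induct)
  case (psubset D)
  show ?case
  proof (cases "\<exists>D'. D' \<subset> D \<and> dependent_family a D'")
    case True
    then obtain D' where D': "D' \<subset> D" "dependent_family a D'" by blast
    with psubset.IH[of D'] psubset.prems show ?thesis by blast
  next
    case False
    with psubset.prems show ?thesis by (intro exI[of _ D]) (auto simp: circuit_def)
  qed
qed

text \<open>
  If a nontrivial relation on a circuit vanished somewhere, it would be a relation on a proper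
  subset of the circuit.
\<close>

lemma circuit_relation_nonzero:
  fixes a :: "'e \<Rightarrow> 'a::real_vector"
  assumes C: "circuit a E C" "finite C" and w: "(\<Sum>i\<in>C. w i *\<^sub>R a i) = 0"
    and "j \<in> C" "w j \<noteq> 0" "i \<in> C"
  shows "w i \<noteq> 0"
proof
  assume "w i = 0"
  then have "(\<Sum>k\<in>C - {i}. w k *\<^sub>R a k) = 0"
    using w C(2) \<open>i \<in> C\<close> by (simp add: sum_diff1)
  moreover have "j \<in> C - {i}" using assms \<open>w i = 0\<close> by auto
  ultimately have "dependent_family a (C - {i})"
    using C(2) \<open>w j \<noteq> 0\<close> by (subst dependent_family_iff) auto
  moreover have "C - {i} \<subset> C" using \<open>i \<in> C\<close> by auto
  ultimately show False using C(1) by (auto simp: circuit_def)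
qed

text \<open>
  Scaling the second relation so that both agree at \<open>j\<close>, their difference vanishes at \<open>j\<close> and is
  therefore trivial: the relations on a circuit form a line.
\<close>

lemma circuit_relations_proportional:
  fixes a :: "'e \<Rightarrow> 'a::real_vector"
  assumes C: "circuit a E C" "finite C"
    and l: "(\<Sum>i\<in>C. l i *\<^sub>R a i) = 0" and w: "(\<Sum>i\<in>C. w i *\<^sub>R a i) = 0"
    and j: "j \<in> C" "w j \<noteq> 0" and i: "i \<in> C"
  shows "l i = l j / w j * w i"
proof -
  define m where "m k = l k - l j / w j * w k" for k
  have "(\<Sum>k\<in>C. m k *\<^sub>R a k) = (\<Sum>k\<in>C. l k *\<^sub>R a k) - (l j / w j) *\<^sub>R (\<Sum>k\<in>C. w k *\<^sub>R a k)"
    by (simp add: m_def scaleR_left_diff_distrib sum_subtractf scaleR_sum_right)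
  then have "(\<Sum>k\<in>C. m k *\<^sub>R a k) = 0" using l w by simp
  moreover have "m j = 0" using j by (simp add: m_def)
  ultimately have "m i = 0" using circuit_relation_nonzero[OF C] i j(1) by blast
  then show ?thesis by (simp add: m_def)
qed

section \<open>Circuits of totally unimodular matrices\<close>

text \<open>
  The cofactors of the last row when the \<open>k\<close> by \<open>Suc k\<close> submatrix with rows \<open>r 0, \<dots>, r (k - 1)\<close> and
  columns \<open>c 0, \<dots>, c k\<close> is bordered below by one more row of \<open>A\<close>.  They do not depend on that row, so
  they are candidates for the coefficients of a linear relation between the columns.
\<close>

definition bordering_cofactor :: "('n \<Rightarrow> 'e \<Rightarrow> int) \<Rightarrow> (nat \<Rightarrow> 'n) \<Rightarrow> (nat \<Rightarrow> 'e) \<Rightarrow> nat \<Rightarrow> nat \<Rightarrow> int" where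
  "bordering_cofactor A r c k j =
     (-1) ^ (k + j) * Determinant.det (Matrix.mat k k (\<lambda>(p, q). A (r p) (c (if q < j then q else Suc q))))"

lemma det_bordered:
  "Determinant.det (Matrix.mat (Suc k) (Suc k) (\<lambda>(p, q). A ((r(k := i)) p) (c q))) =
   (\<Sum>j<Suc k. A i (c j) * bordering_cofactor A r c k j)"
proof -
  let ?M = "Matrix.mat (Suc k) (Suc k) (\<lambda>(p, q). A ((r(k := i)) p) (c q))"
  have "Determinant.det ?M = (\<Sum>j<Suc k. ?M $$ (k, j) * cofactor ?M k j)"
    by (rule laplace_expansion_row) auto
  also have "\<dots> = (\<Sum>j<Suc k. A i (c j) * bordering_cofactor A r c k j)"
  proof (rule sum.cong[OF refl])
    fix j assume j: "j \<in> {..<Suc k}"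
    have "mat_delete ?M k j = Matrix.mat k k (\<lambda>(p, q). A (r p) (c (if q < j then q else Suc q)))"
      using j by (intro eq_matI) (auto simp: mat_delete_def)
    then show "?M $$ (k, j) * cofactor ?M k j = A i (c j) * bordering_cofactor A r c k j"
      using j by (simp add: cofactor_def bordering_cofactor_def)
  qed
  finally show ?thesis .
qed

lemma bordering_cofactor_last:
  "bordering_cofactor A r c k k = Determinant.det (Matrix.mat k k (\<lambda>(p, q). A (r p) (c q)))"
proof -
  have "Matrix.mat k k (\<lambda>(p, q). A (r p) (c (if q < k then q else Suc q))) =
        Matrix.mat k k (\<lambda>(p, q). A (r p) (c q))"
    by (intro eq_matI) auto
  then show ?thesis by (simp add: bordering_cofactor_def flip: mult_2)
qed

lemma real_column_sum_eq_0_iff: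
  "(\<Sum>j\<in>J. real_of_int (w j) *\<^sub>R real_column A (c j)) = 0 \<longleftrightarrow> (\<forall>i. (\<Sum>j\<in>J. A i (c j) * w j) = 0)"
proof -
  have row: "vec_nth (\<Sum>j\<in>J. real_of_int (w j) *\<^sub>R real_column A (c j)) i = real_of_int (\<Sum>j\<in>J. A i (c j) * w j)"
    for i by (simp add: real_column_def mult.commute)
  show ?thesis unfolding Finite_Cartesian_Product.vec_eq_iff row by (simp del: of_int_sum)
qed

text \<open>
  The rows are chosen one at a time.  If no row could border a nonzero minor to a nonzero minor, then
  the bordering cofactors would be a relation between the columns, and a nontrivial one, because the
  cofactor of the new column is the minor already found.
\<close>

lemma independent_columns_minor:
  fixes A :: "'n::finite \<Rightarrow> 'e \<Rightarrow> int"
  assumes "inj_on c {..<k}" "\<not> dependent_family (real_column A) (c ` {..<k})"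
  shows "\<exists>r. inj_on r {..<k} \<and> Determinant.det (Matrix.mat k k (\<lambda>(i, j). A (r i) (c j))) \<noteq> 0"
  using assms
proof (induction k)
  case 0
  show ?case by simp
next
  case (Suc k)
  have "inj_on c {..<k}" using Suc.prems(1) by (rule inj_on_subset) auto
  moreover have "\<not> dependent_family (real_column A) (c ` {..<k})"
    using Suc.prems(2) by (meson dependent_family_mono image_mono lessThan_subset_iff le_SucI order_refl)
  ultimately obtain r where r: "inj_on r {..<k}"
    and det: "Determinant.det (Matrix.mat k k (\<lambda>(i, j). A (r i) (c j))) \<noteq> 0"
    using Suc.IH by blast
  let ?w = "bordering_cofactor A r c k"
  have "\<not> (\<forall>i. (\<Sum>j<Suc k. A i (c j) * ?w j) = 0)"
  proof
    assume "\<forall>i. (\<Sum>j<Suc k. A i (c j) * ?w j) = 0"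
    then have "(\<Sum>j<Suc k. real_of_int (?w j) *\<^sub>R real_column A (c j)) = 0"
      unfolding real_column_sum_eq_0_iff .
    moreover have "(\<Sum>j<Suc k. real_of_int (?w j) *\<^sub>R real_column A (c j)) =
      (\<Sum>e\<in>c ` {..<Suc k}. real_of_int (?w (inv_into {..<Suc k} c e)) *\<^sub>R real_column A e)"
      using Suc.prems(1) by (simp add: sum.reindex del: lessThan_Suc sum.lessThan_Suc)
    moreover have "?w (inv_into {..<Suc k} c (c k)) \<noteq> 0"
      using Suc.prems(1) det by (subst inv_into_f_f) (auto simp: bordering_cofactor_last)
    ultimately have "dependent_family (real_column A) (c ` {..<Suc k})"
      by (subst dependent_family_iff)
        (auto intro!: exI[of _ "\<lambda>e. real_of_int (?w (inv_into {..<Suc k} c e))"] bexI[of _ "c k"])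
    then show False using Suc.prems(2) by blast
  qed
  then obtain i where i: "(\<Sum>j<Suc k. A i (c j) * ?w j) \<noteq> 0" by blast
  let ?M = "Matrix.mat (Suc k) (Suc k) (\<lambda>(p, q). A ((r(k := i)) p) (c q))"
  have det': "Determinant.det ?M \<noteq> 0" using i unfolding det_bordered .
  \<comment> \<open>a row that is already present would make two rows of the bordered matrix equal\<close>
  have "i \<notin> r ` {..<k}"
  proof
    assume "i \<in> r ` {..<k}"
    then obtain p where p: "p < k" "i = r p" by auto
    have "Determinant.det ?M = 0"
    proof (rule det_identical_rows[of _ "Suc k" p k])
      show "Matrix.row ?M p = Matrix.row ?M k" using p by (intro eq_vecI) auto
    qed (use p in auto)
    then show False using det' by simp
  qed
  then have "inj_on (r(k := i)) {..<Suc k}"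
    using r by (auto simp: inj_on_def)
  with det' show ?case by blast
qed

lemma det_dependent_columns:
  fixes A :: "'n::finite \<Rightarrow> 'e \<Rightarrow> int"
  assumes inj: "inj_on c {..<k}" and dep: "dependent_family (real_column A) (c ` {..<k})"
  shows "Determinant.det (Matrix.mat k k (\<lambda>(i, j). A (r i) (c j))) = 0"
proof -
  let ?M = "Matrix.mat k k (\<lambda>(i, j). A (r i) (c j))"
  let ?R = "map_mat real_of_int ?M"
  obtain l i where l: "(\<Sum>e\<in>c ` {..<k}. l e *\<^sub>R real_column A e) = 0" and i: "i < k" "l (c i) \<noteq> 0"
    using dep by (subst (asm) dependent_family_iff) auto
  have l': "(\<Sum>j<k. l (c j) *\<^sub>R real_column A (c j)) = 0" using l inj by (simp add: sum.reindex)
  have row: "(\<Sum>j<k. real_of_int (A i (c j)) * l (c j)) = 0" for i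
  proof -
    have "vec_nth (\<Sum>j<k. l (c j) *\<^sub>R real_column A (c j)) i = 0" using l' by simp
    then show ?thesis by (simp add: real_column_def mult.commute)
  qed
  define v where "v = Matrix.vec k (\<lambda>j. l (c j))"
  have "v \<in> carrier_vec k" by (simp add: v_def)
  moreover have "v \<noteq> 0\<^sub>v k"
  proof
    assume "v = 0\<^sub>v k"
    then have "vec_index v i = 0" using i by simp
    then show False using i by (simp add: v_def)
  qed
  moreover have "?R *\<^sub>v v = 0\<^sub>v k"
    using row by (intro eq_vecI) (auto simp: v_def scalar_prod_def atLeast0LessThan)
  ultimately have "Determinant.det ?R = 0"
    using det_0_iff_vec_prod_zero[of ?R k] by auto
  then show ?thesis by simp
qed

text \<open>
  Leaving out one column of a circuit gives independent columns, hence a nonzero minor.  Every minor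
  bordering it vanishes, so the bordering cofactors form a nontrivial relation on the circuit.  By
  total unimodularity their values are \<open>0\<close>, \<open>1\<close> or \<open>-1\<close>, and on a circuit they cannot be \<open>0\<close>.
  All other relations on the circuit are multiples of this one.
\<close>

lemma totally_unimodular_circuit_relation:
  fixes A :: "'n::finite \<Rightarrow> 'e \<Rightarrow> int"
  assumes tu: "totally_unimodular A E" and C: "circuit (real_column A) E C" "finite C"
    and l: "(\<Sum>i\<in>C. l i *\<^sub>R real_column A i) = 0" and ij: "i \<in> C" "j \<in> C"
  shows "\<bar>l i\<bar> = \<bar>l j\<bar>"
proof -
  have "C \<noteq> {}" using ij by auto
  then obtain k where k: "card C = Suc k" using C(2) by (metis card_gt_0_iff gr0_implies_Suc)
  obtain c where c: "bij_betw c {..<Suc k} C"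
    using ex_bij_betw_nat_finite[OF C(2)] k by (auto simp: atLeast0LessThan)
  have inj: "inj_on c {..<Suc k}" and im: "c ` {..<Suc k} = C" using c by (auto simp: bij_betw_def)
  have CE: "C \<subseteq> E" using C by (auto simp: circuit_def)
  have "c k \<notin> c ` {..<k}"
  proof
    assume "c k \<in> c ` {..<k}"
    then obtain j where "j < k" "c k = c j" by auto
    then show False using inj_onD[OF inj, of k j] by simp
  qed
  then have "c ` {..<k} \<subset> C" using im by (auto simp: lessThan_Suc)
  then have "\<not> dependent_family (real_column A) (c ` {..<k})" using C by (auto simp: circuit_def)
  moreover have "inj_on c {..<k}" using inj by (rule inj_on_subset) auto
  ultimately obtain r where r: "inj_on r {..<k}"
    and det: "Determinant.det (Matrix.mat k k (\<lambda>(i, j). A (r i) (c j))) \<noteq> 0"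
    using independent_columns_minor by blast
  let ?w = "bordering_cofactor A r c k"
  have "\<forall>i. (\<Sum>j<Suc k. A i (c j) * ?w j) = 0"
    using C inj im unfolding det_bordered[symmetric]
    by (auto intro!: det_dependent_columns simp: circuit_def simp del: lessThan_Suc)
  then have sum0: "(\<Sum>j<Suc k. real_of_int (?w j) *\<^sub>R real_column A (c j)) = 0"
    unfolding real_column_sum_eq_0_iff .
  have w_cases: "?w j \<in> {0, 1, -1}" if "j < Suc k" for j
  proof -
    let ?c = "\<lambda>q. c (if q < j then q else Suc q)"
    have "inj_on (c \<circ> (\<lambda>q. if q < j then q else Suc q)) {..<k}"
      using that by (intro comp_inj_on inj_on_subset[OF inj]) (auto simp: inj_on_def split: if_splits)
    then have "inj_on ?c {..<k}" by (simp add: o_def)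
    moreover have "?c ` {..<k} \<subseteq> E" using im CE that by auto
    ultimately have "Determinant.det (Matrix.mat k k (\<lambda>(p, q). A (r p) (?c q))) \<in> {0, 1, -1}"
      using tu r unfolding totally_unimodular_def by blast
    then show ?thesis
      unfolding bordering_cofactor_def by (cases "even (k + j)") auto
  qed
  define u where "u e = real_of_int (?w (inv_into {..<Suc k} c e))" for e
  have u0: "(\<Sum>e\<in>C. u e *\<^sub>R real_column A e) = 0"
    using sum0 inj unfolding im[symmetric] u_def
    by (simp add: sum.reindex del: lessThan_Suc sum.lessThan_Suc)
  have ck: "c k \<in> C" using im by auto
  have uk: "u (c k) \<noteq> 0"
    using inj det unfolding u_def by (subst inv_into_f_f) (auto simp: bordering_cofactor_last)
  have "u e \<in> {0, 1, -1}" if "e \<in> C" for e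
  proof -
    have "inv_into {..<Suc k} c e \<in> {..<Suc k}" using that im by (intro inv_into_into) simp
    then show ?thesis using w_cases unfolding u_def by force
  qed
  moreover have "u e \<noteq> 0" if "e \<in> C" for e
    using circuit_relation_nonzero[OF C u0 ck uk that] .
  ultimately have "\<bar>u e\<bar> = 1" if "e \<in> C" for e using that by fastforce
  moreover have "l e = l (c k) / u (c k) * u e" if "e \<in> C" for e
    using circuit_relations_proportional[OF C l u0 ck uk that] .
  ultimately show ?thesis using ij by (metis abs_mult)
qed

section \<open>Relations between the columns are coboundaries\<close>

definition coboundary :: "('v, 'e) pre_digraph \<Rightarrow> ('v \<Rightarrow> real) \<Rightarrow> 'e \<Rightarrow> real" where
  "coboundary G \<phi> e = \<phi> (head G e) - \<phi> (tail G e)"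

definition crossing :: "('v, 'e) pre_digraph \<Rightarrow> 'v set \<Rightarrow> 'e set" where
  "crossing G W = {e \<in> arcs G. (tail G e \<in> W) \<noteq> (head G e \<in> W)}"

lemma coboundary_indicator:
  assumes "wf_digraph G" "vertex_partition G V1 V2" "e \<in> arcs G"
  shows "coboundary G (indicator V2) e =
    (if e \<in> directed_cut G V1 V2 then 1 else if e \<in> directed_cut G V2 V1 then -1 else 0)"
  using assms(2,3) wf_digraph.tail_in_verts[OF assms(1,3)] wf_digraph.head_in_verts[OF assms(1,3)]
  by (auto simp: coboundary_def directed_cut_def vertex_partition_def indicator_def)

lemma directed_cuts_crossing:
  assumes "wf_digraph G" "vertex_partition G V1 V2"
  shows "directed_cut G V1 V2 \<union> directed_cut G V2 V1 = crossing G V2"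
  using assms(2) wf_digraph.tail_in_verts[OF assms(1)] wf_digraph.head_in_verts[OF assms(1)]
  unfolding directed_cut_def vertex_partition_def crossing_def by blast

lemma cut_iff_crossing:
  assumes "wf_digraph G"
  shows "cut G D \<longleftrightarrow> (\<exists>W\<subseteq>verts G. D = crossing G W)"
proof
  assume "cut G D"
  then obtain V1 V2 where V: "vertex_partition G V1 V2"
    and D: "D = directed_cut G V1 V2 \<union> directed_cut G V2 V1" by (auto simp: cut_def)
  then show "\<exists>W\<subseteq>verts G. D = crossing G W"
    using directed_cuts_crossing[OF assms V] by (intro exI[of _ V2]) (auto simp: vertex_partition_def)
next
  assume "\<exists>W\<subseteq>verts G. D = crossing G W"
  then obtain W where W: "W \<subseteq> verts G" "D = crossing G W" by blast
  have V: "vertex_partition G (verts G - W) W" using W by (auto simp: vertex_partition_def)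
  then show "cut G D" using directed_cuts_crossing[OF assms V] W unfolding cut_def by metis
qed

locale dual_representation = fin_digraph G
  for G :: "('v, 'e) pre_digraph" +
  fixes A :: "'n::finite \<Rightarrow> 'e \<Rightarrow> int"
  assumes unimodular: "totally_unimodular A (arcs G)"
    and dual: "represents_oriented_dual A G"
begin

definition combination :: "('e \<Rightarrow> real) \<Rightarrow> real ^ 'n" where
  "combination x = (\<Sum>e\<in>arcs G. x e *\<^sub>R real_column A e)"

lemma combination_add: "combination (\<lambda>e. x e + y e) = combination x + combination y"
  by (simp add: combination_def scaleR_left_distrib sum.distrib)

lemma combination_diff: "combination (\<lambda>e. x e - y e) = combination x - combination y"
  by (simp add: combination_def scaleR_left_diff_distrib sum_subtractf)

lemma combination_scale: "combination (\<lambda>e. c * x e) = c *\<^sub>R combination x"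
  by (simp add: combination_def scaleR_sum_right)

lemma combination_cong: "(\<And>e. e \<in> arcs G \<Longrightarrow> x e = y e) \<Longrightarrow> combination x = combination y"
  unfolding combination_def by (rule sum.cong) auto

lemma combination_supported:
  assumes "S \<subseteq> arcs G" "\<And>e. e \<in> arcs G - S \<Longrightarrow> x e = 0"
  shows "combination x = (\<Sum>e\<in>S. x e *\<^sub>R real_column A e)"
  unfolding combination_def using assms by (intro sum.mono_neutral_right) auto

text \<open>
  Being a signed circuit, the cut carries a relation with the signs of its cut vector, and by total
  unimodularity all coefficients have the same absolute value.
\<close>

lemma elementary_cut_relation:
  assumes V: "vertex_partition G V1 V2"
    and el: "elementary_cut G (directed_cut G V1 V2 \<union> directed_cut G V2 V1)"
  shows "combination (coboundary G (indicator V2)) = 0"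
proof -
  let ?P = "directed_cut G V1 V2" and ?N = "directed_cut G V2 V1"
  let ?\<delta> = "coboundary G (indicator V2)"
  have "(?P, ?N) \<in> signed_circuits (real_column A) (arcs G)"
    using dual V el unfolding represents_oriented_dual_def signed_elementary_cuts_def by blast
  then obtain l where C: "circuit (real_column A) (arcs G) (?P \<union> ?N)" and disj: "?P \<inter> ?N = {}"
    and l: "(\<Sum>i\<in>?P \<union> ?N. l i *\<^sub>R real_column A i) = 0" "\<forall>i\<in>?P. l i > 0" "\<forall>i\<in>?N. l i < 0"
    unfolding signed_circuits_def by blast
  have sub: "?P \<union> ?N \<subseteq> arcs G" by (auto simp: directed_cut_def)
  then have fin: "finite (?P \<union> ?N)" by (rule finite_subset) simp
  obtain i where i: "i \<in> ?P \<union> ?N" using el by (auto simp: elementary_cut_def)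
  define t where "t = \<bar>l i\<bar>"
  have "t \<noteq> 0" using i l by (auto simp: t_def)
  have lt: "l j = t * ?\<delta> j" if j: "j \<in> ?P \<union> ?N" for j
  proof -
    have "\<bar>l j\<bar> = t" unfolding t_def
      using totally_unimodular_circuit_relation[OF unimodular C fin l(1) j i] .
    moreover have "j \<in> arcs G" using j sub by auto
    ultimately show ?thesis
      using coboundary_indicator[OF wf_digraph V] j l disj by auto
  qed
  have "combination ?\<delta> = (\<Sum>j\<in>?P \<union> ?N. ?\<delta> j *\<^sub>R real_column A j)"
    using sub coboundary_indicator[OF wf_digraph V] by (intro combination_supported) auto
  moreover have "t *\<^sub>R (\<Sum>j\<in>?P \<union> ?N. ?\<delta> j *\<^sub>R real_column A j) = (\<Sum>j\<in>?P \<union> ?N. l j *\<^sub>R real_column A j)"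
    unfolding scaleR_sum_right by (rule sum.cong) (simp_all add: lt)
  ultimately show ?thesis using l(1) \<open>t \<noteq> 0\<close> by simp
qed

text \<open>
  A cut that is not elementary properly contains another nonempty cut, the one of \<open>W'\<close>, say.  An arc that
  joined two of the four cells cut out by \<open>W\<close> and \<open>W'\<close> and crossed \<open>W'\<close> only would violate the
  inclusion of cuts, so no arc joins \<open>W \<inter> W'\<close> to \<open>W - W'\<close>, nor the two outer cells to each other.
  Hence the cut of \<open>W\<close> is the disjoint union of the cuts of \<open>W \<inter> W'\<close> and \<open>W - W'\<close>, and also of the cuts
  of the two outer cells.  One of these decompositions is proper, and induction on the size of the
  cut applies to its parts.
\<close>

lemma vertex_set_relation:
  assumes "W \<subseteq> verts G"
  shows "combination (coboundary G (indicator W)) = 0"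
  using assms
proof (induction "card (crossing G W)" arbitrary: W rule: less_induct)
  case less
  have fin: "finite (crossing G U)" for U by (simp add: crossing_def)
  have IH: "combination (coboundary G (indicator U)) = 0"
    if "crossing G U \<subset> crossing G W" "U \<subseteq> verts G" for U
    using less.hyps[of U] that psubset_card_mono[OF fin] by blast
  have V: "vertex_partition G (verts G - W) W" using less.prems by (auto simp: vertex_partition_def)
  consider (empty) "crossing G W = {}" | (elementary) "elementary_cut G (crossing G W)"
    | (split) D' where "cut G D'" "D' \<noteq> {}" "D' \<subset> crossing G W"
    using cut_iff_crossing[OF wf_digraph] less.prems unfolding elementary_cut_def by metis
  then show ?case
  proof cases
    case empty
    then have "coboundary G (indicator W) e = 0" if "e \<in> arcs G" for e
      using that by (auto simp: crossing_def coboundary_def indicator_def)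
    then show ?thesis by (simp add: combination_def)
  next
    case elementary
    then show ?thesis using elementary_cut_relation[OF V] directed_cuts_crossing[OF wf_digraph V] by simp
  next
    case split
    then obtain W' where W': "W' \<subseteq> verts G" "D' = crossing G W'"
      using cut_iff_crossing[OF wf_digraph] by blast
    \<comment> \<open>the cell pairs joined by these two arcs decide which decomposition is proper\<close>
    obtain f where f: "f \<in> crossing G W'" using split W' by blast
    obtain g where g: "g \<in> crossing G W" "g \<notin> crossing G W'" using split W' by blast
    have sub: "e \<in> crossing G W" if "e \<in> crossing G W'" for e using split W' that by blast
    let ?X = "W \<inter> W'" and ?X' = "W - W'" and ?Y = "W' - W" and ?Y' = "verts G - W - W'"
    have le: "crossing G U \<subseteq> crossing G W" if "U \<in> {?X, ?X', ?Y, ?Y'}" for U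
      using that sub by (auto simp: crossing_def)
    have "(crossing G ?X \<noteq> crossing G W \<and> crossing G ?X' \<noteq> crossing G W) \<or>
          (crossing G ?Y \<noteq> crossing G W \<and> crossing G ?Y' \<noteq> crossing G W)"
    proof -
      have fW: "f \<in> crossing G W" using f sub by blast
      have neq: "crossing G U \<noteq> crossing G W" if "h \<in> crossing G W" "h \<notin> crossing G U" for h U
        using that by blast
      have inV: "tail G f \<in> verts G" "head G f \<in> verts G" "tail G g \<in> verts G" "head G g \<in> verts G"
        using f g by (auto simp: crossing_def)
      have "(f \<notin> crossing G ?X \<and> g \<notin> crossing G ?X') \<or> (g \<notin> crossing G ?X \<and> f \<notin> crossing G ?X') \<or>
            (f \<notin> crossing G ?Y \<and> g \<notin> crossing G ?Y') \<or> (g \<notin> crossing G ?Y \<and> f \<notin> crossing G ?Y')"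
        using f fW g inV unfolding crossing_def
        by (cases "tail G f \<in> W"; cases "tail G f \<in> W'"; cases "tail G g \<in> W"; cases "tail G g \<in> W'") simp_all
      then show ?thesis using neq[OF fW] neq[OF g(1)] by blast
    qed
    then show ?thesis
    proof
      assume *: "crossing G ?X \<noteq> crossing G W \<and> crossing G ?X' \<noteq> crossing G W"
      have "combination (coboundary G (indicator W)) =
            combination (\<lambda>e. coboundary G (indicator ?X) e + coboundary G (indicator ?X') e)"
        by (rule combination_cong) (auto simp: coboundary_def indicator_def)
      also have "\<dots> = 0"
        using * le less.prems IH[of ?X] IH[of ?X'] unfolding combination_add
        by (simp add: psubset_eq le_infI1 subset_insertI2 Diff_subset_conv le_supI2)
      finally show ?thesis .
    next
      assume *: "crossing G ?Y \<noteq> crossing G W \<and> crossing G ?Y' \<noteq> crossing G W"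
      have "combination (coboundary G (indicator W)) =
            combination (\<lambda>e. (-1) * (coboundary G (indicator ?Y) e + coboundary G (indicator ?Y') e))"
        by (rule combination_cong) (auto simp: coboundary_def indicator_def)
      also have "\<dots> = 0"
        using * le W'(1) IH[of ?Y] IH[of ?Y'] unfolding combination_scale combination_add
        by (simp add: psubset_eq Diff_subset_conv le_supI2)
      finally show ?thesis .
    qed
  qed
qed

text \<open>
  Every potential is a linear combination of indicator functions of single vertices.
\<close>

lemma coboundary_relation: "combination (coboundary G \<phi>) = 0"
proof -
  have "coboundary G \<phi> e = (\<Sum>v\<in>verts G. \<phi> v * coboundary G (indicator {v}) e)" if "e \<in> arcs G" for e
  proof -
    have "(\<Sum>v\<in>verts G. \<phi> v * coboundary G (indicator {v}) e) =
      (\<Sum>v\<in>verts G. (if v = head G e then \<phi> v else 0) - (if v = tail G e then \<phi> v else 0))"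
      by (rule sum.cong) (auto simp: coboundary_def indicator_def)
    also have "\<dots> = coboundary G \<phi> e"
      using that by (simp add: sum_subtractf sum.delta coboundary_def)
    finally show ?thesis by simp
  qed
  then have "combination (coboundary G \<phi>) =
      combination (\<lambda>e. \<Sum>v\<in>verts G. \<phi> v * coboundary G (indicator {v}) e)"
    by (rule combination_cong)
  also have "\<dots> = (\<Sum>v\<in>verts G. \<phi> v *\<^sub>R combination (coboundary G (indicator {v})))"
    unfolding combination_def scaleR_sum_left scaleR_sum_right by (subst sum.swap) simp
  also have "\<dots> = 0" by (intro sum.neutral) (simp add: vertex_set_relation)
  finally show ?thesis .
qed

text \<open>
  The support of a nontrivial relation contains a circuit.  This circuit is an elementary cut, and its
  cut vector is supported exactly on it.  Subtracting the multiple of the cut vector that clears one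
  coefficient leaves a relation with smaller support.
\<close>

lemma relation_is_coboundary:
  assumes "combination x = 0"
  shows "\<exists>\<phi>. \<forall>e\<in>arcs G. x e = coboundary G \<phi> e"
  using assms
proof (induction "card {e \<in> arcs G. x e \<noteq> 0}" arbitrary: x rule: less_induct)
  case less
  let ?S = "{e \<in> arcs G. x e \<noteq> 0}"
  show ?case
  proof (cases "?S = {}")
    case True
    then show ?thesis by (intro exI[of _ "\<lambda>_. 0"]) (auto simp: coboundary_def)
  next
    case False
    have "(\<Sum>e\<in>?S. x e *\<^sub>R real_column A e) = 0"
      using less.prems by (subst combination_supported[symmetric]) auto
    then have "dependent_family (real_column A) ?S"
      using False by (subst dependent_family_iff) (auto intro!: exI[of _ x])
    then obtain C where CS: "C \<subseteq> ?S" and C: "circuit (real_column A) (arcs G) C"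
      using circuit_in_dependent_family[of ?S "arcs G"] by auto
    have fC: "finite C" using CS by (rule finite_subset) simp
    obtain l i where l: "(\<Sum>e\<in>C. l e *\<^sub>R real_column A e) = 0" and i: "i \<in> C" "l i \<noteq> 0"
    proof -
      have "dependent_family (real_column A) C" using C by (simp add: circuit_def)
      then show thesis using that unfolding dependent_family_iff[OF fC] by blast
    qed
    have l0: "l e \<noteq> 0" if "e \<in> C" for e using circuit_relation_nonzero[OF C fC l i that] .
    have "{e \<in> C. l e > 0} \<union> {e \<in> C. l e < 0} = C" using l0 by (auto simp: neq_iff)
    then have "({e \<in> C. l e > 0}, {e \<in> C. l e < 0}) \<in> signed_circuits (real_column A) (arcs G)"
      unfolding signed_circuits_def using C l by (intro CollectI case_prodI) (auto intro!: exI[of _ l])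
    then obtain V1 V2 where V: "vertex_partition G V1 V2"
      and PN: "{e \<in> C. l e > 0} = directed_cut G V1 V2" "{e \<in> C. l e < 0} = directed_cut G V2 V1"
      unfolding dual[unfolded represents_oriented_dual_def] signed_elementary_cuts_def by blast
    let ?w = "coboundary G (indicator V2)"
    have w0: "?w e \<noteq> 0 \<longleftrightarrow> e \<in> C" if "e \<in> arcs G" for e
      using coboundary_indicator[OF wf_digraph V that] l0[of e] unfolding PN[symmetric] by auto
    define c where "c = x i / ?w i"
    define y where "y e = x e - c * ?w e" for e
    have iG: "i \<in> arcs G" using i CS by auto
    have "combination y = 0"
      unfolding y_def combination_diff combination_scale coboundary_relation using less.prems by simp
    moreover have "{e \<in> arcs G. y e \<noteq> 0} \<subset> ?S"
    proof (rule psubsetI)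
      show "{e \<in> arcs G. y e \<noteq> 0} \<subseteq> ?S" using w0 CS unfolding y_def by force
      have "y i = 0" using w0[OF iG] i by (simp add: y_def c_def)
      then show "{e \<in> arcs G. y e \<noteq> 0} \<noteq> ?S" using i CS by blast
    qed
    ultimately obtain \<phi> where \<phi>: "\<forall>e\<in>arcs G. y e = coboundary G \<phi> e"
      using less.hyps[of y] psubset_card_mono[of ?S] by auto
    have "\<forall>e\<in>arcs G. x e = coboundary G (\<lambda>v. \<phi> v + c * indicator V2 v) e"
      using \<phi> by (auto simp: y_def coboundary_def algebra_simps)
    then show ?thesis by blast
  qed
qed

end

section \<open>Spanning arborescences grown from the root\<close>

text \<open>
  An arborescence with vertex set \<open>R\<close> and arc set \<open>T\<close>, built by attaching one new vertex after another.
  This form makes statements about potentials and about reachability from the root provable by rule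
  induction.
\<close>

inductive grown_arborescence :: "('v, 'e) pre_digraph \<Rightarrow> 'v \<Rightarrow> 'v set \<Rightarrow> 'e set \<Rightarrow> bool"
  for G :: "('v, 'e) pre_digraph" and v\<^sub>0 :: 'v where
  root: "grown_arborescence G v\<^sub>0 {v\<^sub>0} {}"
| grow: "\<lbrakk>grown_arborescence G v\<^sub>0 R T; e \<in> arcs G; tail G e \<in> R; head G e \<notin> R\<rbrakk>
    \<Longrightarrow> grown_arborescence G v\<^sub>0 (insert (head G e) R) (insert e T)"

lemma grown_arborescence_root: "grown_arborescence G v\<^sub>0 R T \<Longrightarrow> v\<^sub>0 \<in> R"
  by (induction rule: grown_arborescence.induct) auto

lemma grown_arborescence_arcs: "grown_arborescence G v\<^sub>0 R T \<Longrightarrow> T \<subseteq> arcs G"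
  by (induction rule: grown_arborescence.induct) auto

lemma grown_arborescence_ends:
  "grown_arborescence G v\<^sub>0 R T \<Longrightarrow> e \<in> T \<Longrightarrow> tail G e \<in> R \<and> head G e \<in> R"
  by (induction rule: grown_arborescence.induct) auto

lemma (in wf_digraph) grown_arborescence_verts:
  "grown_arborescence G v\<^sub>0 R T \<Longrightarrow> v\<^sub>0 \<in> verts G \<Longrightarrow> R \<subseteq> verts G"
  by (induction rule: grown_arborescence.induct) auto

text \<open>
  Each new vertex hangs on a single arc, so its potential can be chosen to give this arc the
  prescribed difference.
\<close>

lemma grown_arborescence_potential:
  assumes "grown_arborescence G v\<^sub>0 R T"
  shows "\<exists>\<phi>. \<forall>e\<in>T. coboundary G \<phi> e = x e"
  using assms
proof (induction rule: grown_arborescence.induct)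
  case (grow R T e)
  then obtain \<phi> where \<phi>: "\<forall>e\<in>T. coboundary G \<phi> e = x e" by blast
  let ?\<phi> = "\<phi>(head G e := \<phi> (tail G e) + x e)"
  have "coboundary G ?\<phi> f = x f" if "f \<in> T" for f
    using grown_arborescence_ends[OF grow.hyps(1) that] grow.hyps(4) \<phi> that
    by (auto simp: coboundary_def)
  moreover have "coboundary G ?\<phi> e = x e"
    using grow.hyps by (auto simp: coboundary_def)
  ultimately show ?case by blast
qed simp

lemma grown_arborescence_monotone:
  assumes "grown_arborescence G v\<^sub>0 R T" "\<And>e. e \<in> T \<Longrightarrow> coboundary G \<phi> e \<ge> 0" "v \<in> R"
  shows "\<phi> v\<^sub>0 \<le> \<phi> v"
  using assms
proof (induction arbitrary: v rule: grown_arborescence.induct)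
  case (grow R T e)
  have "\<phi> v\<^sub>0 \<le> \<phi> (tail G e)" using grow by auto
  also have "\<phi> (tail G e) \<le> \<phi> (head G e)" using grow.prems(1)[of e] by (simp add: coboundary_def)
  finally show ?case using grow by auto
qed simp

text \<open>
  Adjacency in the underlying undirected graph, using only the arcs in \<open>T\<close>.
\<close>

definition joined :: "('v, 'e) pre_digraph \<Rightarrow> 'e set \<Rightarrow> 'v rel" where
  "joined G T = (\<Union>e\<in>T. {(tail G e, head G e), (head G e, tail G e)})"

lemma joined_mono: "T \<subseteq> U \<Longrightarrow> (joined G T)\<^sup>* \<subseteq> (joined G U)\<^sup>*"
  by (intro rtrancl_mono) (auto simp: joined_def)

lemma joined_sym: "(u, v) \<in> (joined G T)\<^sup>* \<Longrightarrow> (v, u) \<in> (joined G T)\<^sup>*"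
  by (rule symD[OF sym_rtrancl]) (auto simp: joined_def sym_def)

lemma reachable_mk_symmetric_iff:
  assumes "wf_digraph H"
  shows "u \<rightarrow>\<^sup>*\<^bsub>with_proj (mk_symmetric H)\<^esub> v \<longleftrightarrow>
    u \<in> verts H \<and> v \<in> verts H \<and> (u, v) \<in> (joined H (arcs H))\<^sup>*"
proof -
  interpret wf_digraph H by fact
  interpret S: pair_wf_digraph "mk_symmetric H" ..
  show ?thesis
    unfolding S.reachable_conv by (auto simp: parcs_mk_symmetric joined_def)
qed

lemma connected_iff_joined:
  assumes "wf_digraph H"
  shows "Digraph_Component.connected H \<longleftrightarrow>
    verts H \<noteq> {} \<and> (\<forall>u\<in>verts H. \<forall>v\<in>verts H. (u, v) \<in> (joined H (arcs H))\<^sup>*)"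
  unfolding connected_def strongly_connected_def reachable_mk_symmetric_iff[OF assms] by auto

lemma grown_arborescence_joined:
  "grown_arborescence G v\<^sub>0 R T \<Longrightarrow> v \<in> R \<Longrightarrow> (v\<^sub>0, v) \<in> (joined G T)\<^sup>*"
proof (induction arbitrary: v rule: grown_arborescence.induct)
  case (grow R T e)
  have old: "(v\<^sub>0, u) \<in> (joined G (insert e T))\<^sup>*" if "u \<in> R" for u
    using grow.IH[OF that] joined_mono[of T "insert e T"] by auto
  have "(tail G e, head G e) \<in> joined G (insert e T)" by (auto simp: joined_def)
  then have "(v\<^sub>0, head G e) \<in> (joined G (insert e T))\<^sup>*"
    using old[OF grow.hyps(3)] by (rule rtrancl_into_rtrancl[rotated])
  then show ?case using old grow.prems by auto
qed simp

text \<open>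
  When an arc is attached, its tail is already connected to the root by earlier arcs.
\<close>

lemma grown_arborescence_tail_joined:
  "grown_arborescence G v\<^sub>0 R T \<Longrightarrow> e \<in> T \<Longrightarrow> (v\<^sub>0, tail G e) \<in> (joined G (T - {e}))\<^sup>*"
proof (induction arbitrary: e rule: grown_arborescence.induct)
  case (grow R T f)
  show ?case
  proof (cases "e = f")
    case True
    have "f \<notin> T" using grown_arborescence_ends[OF grow.hyps(1)] grow.hyps(4) by auto
    then have "T \<subseteq> insert f T - {e}" using True by auto
    then show ?thesis
      using grown_arborescence_joined[OF grow.hyps(1) grow.hyps(3)] True joined_mono by blast
  next
    case False
    then have "(v\<^sub>0, tail G e) \<in> (joined G (T - {e}))\<^sup>*" using grow by auto
    moreover have "T - {e} \<subseteq> insert f T - {e}" by auto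
    ultimately show ?thesis using joined_mono by blast
  qed
qed simp

lemma coboundary_along_walk:
  assumes "pre_digraph.cas (both_directions F) u p v"
  shows "(\<Sum>(e, fwd)\<leftarrow>p. if fwd then coboundary F \<phi> e else - coboundary F \<phi> e) = \<phi> v - \<phi> u"
  using assms
proof (induction p arbitrary: u)
  case Nil
  then show ?case by (simp add: pre_digraph.cas.simps)
next
  case (Cons d p)
  then show ?case
    by (cases d) (auto simp: pre_digraph.cas.simps both_directions_def coboundary_def)
qed

text \<open>
  A potential whose differences are \<open>1\<close> on one arc of a cycle and \<open>0\<close> on all other arcs cannot exist: the
  signed differences along a closed walk cancel, but the chosen arc is passed exactly once.
\<close>

lemma no_undirected_cycle_if_potentials:
  assumes pot: "\<And>x. \<exists>\<phi>. \<forall>e\<in>arcs F. coboundary F \<phi> e = x e"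
  shows "\<not> undirected_cycle F p"
proof
  assume "undirected_cycle F p"
  then obtain u where walk: "pre_digraph.awalk (both_directions F) u p u"
    and "p \<noteq> []" and dist: "distinct (map fst p)"
    by (auto simp: undirected_cycle_def pre_digraph.cycle_def)
  then obtain e b q where p: "p = (e, b) # q" by (cases p) auto
  have arcs: "fst ` set p \<subseteq> arcs F" and cas: "pre_digraph.cas (both_directions F) u p u"
    using walk by (auto simp: pre_digraph.awalk_def both_directions_def)
  obtain \<phi> where \<phi>: "\<forall>f\<in>arcs F. coboundary F \<phi> f = (if f = e then 1 else 0)"
    using pot[of "\<lambda>f. if f = e then 1 else 0"] by blast
  have "(\<Sum>(f, fwd)\<leftarrow>q. if fwd then coboundary F \<phi> f else - coboundary F \<phi> f) = (\<Sum>d\<leftarrow>q. 0)"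
  proof (intro arg_cong[where f = sum_list] map_cong refl)
    fix d assume d: "d \<in> set q"
    have "fst d \<noteq> e" using dist d by (auto simp: p)
    moreover have "fst d \<in> arcs F" using arcs d by (auto simp: p)
    ultimately show "(case d of (f, fwd) \<Rightarrow> if fwd then coboundary F \<phi> f else - coboundary F \<phi> f) = 0"
      using \<phi> by (auto split: prod.split)
  qed
  moreover have "coboundary F \<phi> e = 1" using \<phi> arcs by (auto simp: p)
  ultimately show False
    using coboundary_along_walk[OF cas, of \<phi>] by (auto simp: p split: if_splits)
qed

lemma wf_both_directions: "wf_digraph F \<Longrightarrow> wf_digraph (both_directions F)"
  by (auto simp: wf_digraph_def both_directions_def)

text \<open>
  Both copies of an arc have the same two ends, and a path that has left a vertex does not return to it.
\<close>

lemma apath_both_directions_distinct: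
  assumes "wf_digraph F" "pre_digraph.apath (both_directions F) u p v"
  shows "distinct (map fst p)"
proof -
  interpret B: wf_digraph "both_directions F" using assms(1) by (rule wf_both_directions)
  show ?thesis using assms(2)
  proof (induction p arbitrary: u)
    case (Cons d p)
    obtain e b where d: "d = (e, b)" by (cases d)
    have path: "B.apath (head (both_directions F) d) p v"
      and new: "tail (both_directions F) d \<notin> set (B.awalk_verts (head (both_directions F) d) p)"
      using Cons.prems by (auto simp: B.apath_Cons_iff)
    have "e \<notin> fst ` set p"
    proof
      assume "e \<in> fst ` set p"
      then obtain c where c: "(e, c) \<in> set p" by auto
      have "tail (both_directions F) d \<in>
          {tail (both_directions F) (e, c), head (both_directions F) (e, c)}"
        by (auto simp: both_directions_def d)
      then show False
        using new B.awalk_verts_arc1[OF c] B.awalk_verts_arc2[OF B.awalkI_apath[OF path] c] by auto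
    qed
    then show ?case using Cons.IH[OF path] d by simp
  qed simp
qed

text \<open>
  A path from the head of \<open>e\<close> to its tail that avoids \<open>e\<close> is closed up to a cycle by \<open>e\<close>.
\<close>

lemma undirected_cycle_if_joined:
  assumes wf: "wf_digraph F" and e: "e \<in> arcs F"
    and conn: "(tail F e, head F e) \<in> (joined F (arcs F - {e}))\<^sup>*"
  shows "\<exists>p. undirected_cycle F p"
proof -
  define H where "H = F\<lparr>arcs := arcs F - {e}\<rparr>"
  have wfH: "wf_digraph H" using wf by (auto simp: H_def wf_digraph_def)
  interpret H: wf_digraph "both_directions H" using wfH by (rule wf_both_directions)
  interpret F: wf_digraph "both_directions F" using wf by (rule wf_both_directions)
  interpret wf_digraph F by fact
  have "joined F (arcs F - {e}) \<subseteq> arcs_ends (both_directions H)"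
    by (force simp: joined_def arcs_ends_conv both_directions_def H_def)
  moreover have "(head F e, tail F e) \<in> (joined F (arcs F - {e}))\<^sup>*" using conn by (rule joined_sym)
  ultimately have "(head F e, tail F e) \<in> (arcs_ends (both_directions H))\<^sup>*"
    using rtrancl_mono by blast
  moreover have "head F e \<in> verts (both_directions H)" using e by (simp add: both_directions_def H_def)
  ultimately have "head F e \<rightarrow>\<^sup>*\<^bsub>both_directions H\<^esub> tail F e"
    using H.reachable_conv' by blast
  then obtain p where p: "H.apath (head F e) p (tail F e)"
    unfolding H.reachable_apath by blast
  have "subgraph (both_directions H) (both_directions F)"
    using H.wf_digraph F.wf_digraph
    by (auto simp: subgraph_def compatible_def both_directions_def H_def)
  then have pF: "F.apath (head F e) p (tail F e)" using p F.subgraph_apath_imp_apath by blast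
  have ends: "tail (both_directions F) (e, True) = tail F e" "head (both_directions F) (e, True) = head F e"
    by (simp_all add: both_directions_def)
  have "F.awalk (tail F e) ((e, True) # p) (tail F e)"
    using e F.awalkI_apath[OF pF] by (simp add: F.awalk_Cons_iff ends) (simp add: both_directions_def)
  moreover have "distinct (tl (F.awalk_verts (tail F e) ((e, True) # p)))"
    using pF by (simp add: F.apath_def ends)
  moreover have "distinct (map fst ((e, True) # p))"
  proof -
    have "set p \<subseteq> arcs (both_directions H)" using H.awalkI_apath[OF p] by auto
    then have "e \<notin> fst ` set p" by (auto simp: both_directions_def H_def)
    then show ?thesis using apath_both_directions_distinct[OF wf pF] by simp
  qed
  ultimately have "undirected_cycle F ((e, True) # p)"
    unfolding undirected_cycle_def F.cycle_def by blast
  then show ?thesis by blast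
qed

context fin_digraph
begin

text \<open>
  Cycles are excluded because arbitrary differences along the arcs can be prescribed for a potential.
\<close>

lemma grown_imp_spanning_arborescence:
  assumes grown: "grown_arborescence G v\<^sub>0 (verts G) T"
  shows "spanning_arborescence_in G v\<^sub>0 (G\<lparr>arcs := T\<rparr>)"
proof -
  let ?F = "G\<lparr>arcs := T\<rparr>"
  have T: "T \<subseteq> arcs G" using grown by (rule grown_arborescence_arcs)
  have v0: "v\<^sub>0 \<in> verts G" using grown by (rule grown_arborescence_root)
  have wfF: "wf_digraph ?F" using T by unfold_locales auto
  have sub: "subgraph ?F G"
    using T wfF wf_digraph by (auto simp: subgraph_def compatible_def)
  have joined_eq: "joined ?F U = joined G U" for U by (simp add: joined_def)
  have "(u, v) \<in> (joined G T)\<^sup>*" if "u \<in> verts G" "v \<in> verts G" for u v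
    using joined_sym[OF grown_arborescence_joined[OF grown that(1)]]
      grown_arborescence_joined[OF grown that(2)] by (rule rtrancl_trans)
  then have "Digraph_Component.connected ?F"
    using v0 by (auto simp: connected_iff_joined[OF wfF] joined_eq)
  moreover have "\<not> undirected_cycle ?F p" for p
    using grown_arborescence_potential[OF grown]
    by (intro no_undirected_cycle_if_potentials) (simp add: coboundary_def)
  moreover have "v\<^sub>0 \<rightarrow>\<^sup>*\<^bsub>with_proj (mk_symmetric (pre_digraph.del_arc ?F e))\<^esub> tail ?F e"
    if e: "e \<in> T" for e
  proof -
    have wfd: "wf_digraph (pre_digraph.del_arc ?F e)"
      using wfF by (auto simp: wf_digraph_def pre_digraph.del_arc_def)
    have "joined (pre_digraph.del_arc ?F e) (T - {e}) = joined G (T - {e})"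
      by (simp add: joined_def pre_digraph.del_arc_def)
    then show ?thesis
      using grown_arborescence_tail_joined[OF grown e] v0 e T
      unfolding reachable_mk_symmetric_iff[OF wfd]
      by (auto simp: pre_digraph.del_arc_def)
  qed
  ultimately show ?thesis
    using sub v0 by (auto simp: spanning_arborescence_in_def arborescence_in_def tree_in_def spanning_def)
qed

text \<open>
  Take a grown arborescence inside \<open>F\<close> with inclusion-maximal vertex set \<open>R\<close>.  If some vertex were missing,
  connectedness would give an arc of \<open>F\<close> between \<open>R\<close> and its complement.  An arc leaving \<open>R\<close> could be
  attached.  For an arc \<open>e\<close> entering \<open>R\<close>, both ends are connected to the root without \<open>e\<close>: the head inside
  \<open>R\<close>, the tail by the orientation of \<open>F\<close>; so \<open>e\<close> would lie on an undirected cycle.  Finally, an arc of \<open>F\<close>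
  outside the grown arborescence would also close a cycle.
\<close>

lemma spanning_arborescence_imp_grown:
  assumes F: "spanning_arborescence_in G v\<^sub>0 F"
  shows "grown_arborescence G v\<^sub>0 (verts G) (arcs F)"
proof -
  have sub: "subgraph F G" and conn: "Digraph_Component.connected F" and acyc: "\<nexists>p. undirected_cycle F p"
    and v0F: "v\<^sub>0 \<in> verts F" and vF: "verts F = verts G"
    and orient: "\<And>e. e \<in> arcs F \<Longrightarrow>
      v\<^sub>0 \<rightarrow>\<^sup>*\<^bsub>with_proj (mk_symmetric (pre_digraph.del_arc F e))\<^esub> tail F e"
    using F by (auto simp: spanning_arborescence_in_def arborescence_in_def tree_in_def spanning_def)
  have wfF: "wf_digraph F" and aF: "arcs F \<subseteq> arcs G" and [simp]: "tail F = tail G" "head F = head G"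
    using sub by (auto simp: subgraph_def compatible_def)
  have [simp]: "joined F = joined G" by (auto simp: joined_def fun_eq_iff)
  have bridge: "(tail G e, head G e) \<notin> (joined G (arcs F - {e}))\<^sup>*" if "e \<in> arcs F" for e
    using undirected_cycle_if_joined[OF wfF that] acyc by auto
  have from_root: "(v\<^sub>0, tail G e) \<in> (joined G (arcs F - {e}))\<^sup>*" if e: "e \<in> arcs F" for e
  proof -
    have wfd: "wf_digraph (pre_digraph.del_arc F e)"
      using wfF by (auto simp: wf_digraph_def pre_digraph.del_arc_def)
    show ?thesis
      using orient[OF e] unfolding reachable_mk_symmetric_iff[OF wfd]
      by (simp add: pre_digraph.del_arc_def joined_def)
  qed
  let ?P = "\<lambda>R. \<exists>T\<subseteq>arcs F. grown_arborescence G v\<^sub>0 R T"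
  have v0: "v\<^sub>0 \<in> verts G" using v0F vF by simp
  define M where "M = {R. ?P R}"
  have "M \<subseteq> Pow (verts G)" using grown_arborescence_verts v0 by (auto simp: M_def)
  then have "finite M" by (rule finite_subset) simp
  moreover have "{v\<^sub>0} \<in> M" unfolding M_def
    by (intro CollectI exI[of _ "{}"]) (simp add: grown_arborescence.root)
  ultimately obtain R where "R \<in> M" and maxM: "\<And>R'. R' \<in> M \<Longrightarrow> R \<subseteq> R' \<Longrightarrow> R = R'"
    using finite_has_maximal[of M] by blast
  then have R: "?P R" and max: "\<And>R'. ?P R' \<Longrightarrow> R \<subseteq> R' \<Longrightarrow> R = R'"
    unfolding M_def by blast+
  obtain T where T: "T \<subseteq> arcs F" and grown: "grown_arborescence G v\<^sub>0 R T" using R by blast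
  have RV: "R \<subseteq> verts G" using grown_arborescence_verts[OF grown v0] .
  have "R = verts G"
  proof (rule ccontr)
    assume "R \<noteq> verts G"
    then obtain w where w: "w \<in> verts G" "w \<notin> R" using RV by auto
    have "(v\<^sub>0, w) \<in> (joined G (arcs F))\<^sup>*"
      using conn w v0 vF by (simp add: connected_iff_joined[OF wfF])
    then have "\<exists>a b. (a, b) \<in> joined G (arcs F) \<and> a \<in> R \<and> b \<notin> R"
      using w(2) grown_arborescence_root[OF grown]
      by (induction rule: rtrancl_induct) blast+
    then obtain e where e: "e \<in> arcs F"
      and "(tail G e \<in> R \<and> head G e \<notin> R) \<or> (head G e \<in> R \<and> tail G e \<notin> R)"
      by (auto simp: joined_def)
    then show False
    proof (elim disjE conjE)
      assume "tail G e \<in> R" and out: "head G e \<notin> R"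
      then have "grown_arborescence G v\<^sub>0 (insert (head G e) R) (insert e T)"
        using grown e aF by (intro grown_arborescence.grow) auto
      moreover have "insert e T \<subseteq> arcs F" using T e by simp
      ultimately have "R = insert (head G e) R" by (intro max) blast+
      then show False using out by blast
    next
      assume "head G e \<in> R" and out: "tail G e \<notin> R"
      then have "(head G e, v\<^sub>0) \<in> (joined G T)\<^sup>*"
        using joined_sym[OF grown_arborescence_joined[OF grown]] by blast
      moreover have "T \<subseteq> arcs F - {e}" using T out grown_arborescence_ends[OF grown] by auto
      ultimately have "(head G e, v\<^sub>0) \<in> (joined G (arcs F - {e}))\<^sup>*" using joined_mono by blast
      then have "(head G e, tail G e) \<in> (joined G (arcs F - {e}))\<^sup>*"
        using from_root[OF e] by (rule rtrancl_trans)
      then show False using bridge[OF e] joined_sym by metis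
    qed
  qed
  moreover have "T = arcs F"
  proof (rule ccontr)
    assume "T \<noteq> arcs F"
    then obtain e where e: "e \<in> arcs F" "e \<notin> T" using T by blast
    have "tail G e \<in> R" "head G e \<in> R" using \<open>R = verts G\<close> e aF by auto
    then have "(tail G e, head G e) \<in> (joined G T)\<^sup>*"
      using joined_sym[OF grown_arborescence_joined[OF grown]] grown_arborescence_joined[OF grown]
      by (meson rtrancl_trans)
    moreover have "T \<subseteq> arcs F - {e}" using T e by blast
    ultimately show False using bridge[OF e(1)] joined_mono by blast
  qed
  ultimately show ?thesis using grown by simp
qed

lemma branching_bases_eq: "branching_bases G v\<^sub>0 = {T. grown_arborescence G v\<^sub>0 (verts G) T}"
proof (intro equalityI subsetI)
  fix T assume "T \<in> {T. grown_arborescence G v\<^sub>0 (verts G) T}"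
  then have "spanning_arborescence_in G v\<^sub>0 (G\<lparr>arcs := T\<rparr>)"
    by (simp add: grown_imp_spanning_arborescence)
  then show "T \<in> branching_bases G v\<^sub>0"
    unfolding branching_bases_def by (intro CollectI exI[of _ "G\<lparr>arcs := T\<rparr>"]) simp
qed (auto simp: branching_bases_def intro: spanning_arborescence_imp_grown)

end

section \<open>Eulerian digraphs\<close>

lemma eulerian_coboundary_sum:
  assumes "eulerian_digraph G"
  shows "(\<Sum>e\<in>arcs G. coboundary G \<phi> e) = 0"
proof -
  interpret fin_digraph G using assms by (simp add: eulerian_digraph_def)
  have "(\<Sum>e\<in>arcs G. \<phi> (head G e)) = (\<Sum>v\<in>verts G. \<Sum>e\<in>in_arcs G v. \<phi> (head G e))"
    unfolding in_arcs_def by (rule sum.group[symmetric]) auto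
  also have "\<dots> = (\<Sum>v\<in>verts G. real (in_degree G v) * \<phi> v)"
    by (simp add: in_degree_def)
  also have "\<dots> = (\<Sum>v\<in>verts G. real (out_degree G v) * \<phi> v)"
    using assms by (intro sum.cong) (auto simp: eulerian_digraph_def)
  also have "\<dots> = (\<Sum>v\<in>verts G. \<Sum>e\<in>out_arcs G v. \<phi> (tail G e))"
    by (simp add: out_degree_def)
  also have "\<dots> = (\<Sum>e\<in>arcs G. \<phi> (tail G e))"
    unfolding out_arcs_def by (rule sum.group) auto
  finally show ?thesis by (simp add: coboundary_def sum_subtractf)
qed

text \<open>
  By connectedness some arc joins \<open>R\<close> to its complement, and in an Eulerian digraph as many arcs leave \<open>R\<close>
  as enter it: the coboundary of the indicator function of \<open>R\<close> is \<open>1\<close> on entering and \<open>-1\<close> on leaving arcs,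
  and its sum is zero.
\<close>

lemma eulerian_leaving_arc:
  assumes G: "eulerian_digraph G" and R: "R \<subset> verts G" "R \<noteq> {}"
  shows "\<exists>e\<in>arcs G. tail G e \<in> R \<and> head G e \<notin> R"
proof (rule ccontr)
  assume none: "\<not> ?thesis"
  interpret fin_digraph G using G by (simp add: eulerian_digraph_def)
  obtain u w where u: "u \<in> R" and w: "w \<in> verts G" "w \<notin> R" using R by blast
  have "(u, w) \<in> (joined G (arcs G))\<^sup>*"
    using G u w R by (auto simp: eulerian_digraph_def connected_iff_joined[OF wf_digraph])
  then have "\<exists>a b. (a, b) \<in> joined G (arcs G) \<and> a \<in> R \<and> b \<notin> R"
    using w(2) u by (induction rule: rtrancl_induct) blast+
  then obtain e where e: "e \<in> arcs G" "tail G e \<notin> R" "head G e \<in> R"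
    using none by (auto simp: joined_def)
  have nonneg: "coboundary G (indicator R) f \<ge> 0" if "f \<in> arcs G" for f
    using none that by (auto simp: coboundary_def indicator_def)
  have "coboundary G (indicator R) e = 1" using e by (simp add: coboundary_def)
  then have "(\<Sum>f\<in>arcs G. coboundary G (indicator R) f) > 0"
    using e(1) nonneg by (intro sum_pos2[of _ e]) auto
  then show False using eulerian_coboundary_sum[OF G] by simp
qed

section \<open>Tight arborescences for nonnegative arc lengths\<close>

lemma coboundary_add: "coboundary G (\<lambda>v. \<phi> v + \<psi> v) e = coboundary G \<phi> e + coboundary G \<psi> e"
  by (simp add: coboundary_def)

lemma coboundary_minus: "coboundary G (\<lambda>v. - \<phi> v) e = - coboundary G \<phi> e"
  by (simp add: coboundary_def)

text \<open>
  This is Dijkstra's algorithm. The numbers \<open>x\<close> are arc lengths, the potential that is found when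
  \<open>R\<close> is the root alone is, up to a constant, the negative of the distance from the root, and
  \<open>x + \<delta>\<phi>\<close> are the reduced lengths, which vanish on a shortest-path arborescence.
  Lowering the potential of all vertices outside \<open>R\<close> by the smallest length of an arc leaving
  \<open>R\<close> keeps all lengths nonnegative, does not change the arcs inside \<open>R\<close>, and makes
  one leaving arc tight, which is then attached.
\<close>

lemma extend_tight_arborescence:
  assumes G: "eulerian_digraph G" and v0: "v\<^sub>0 \<in> verts G"
    and "grown_arborescence G v\<^sub>0 R T" "\<And>e. e \<in> arcs G \<Longrightarrow> x e \<ge> 0" "\<And>e. e \<in> T \<Longrightarrow> x e = 0"
  shows "\<exists>\<phi> T'. (\<forall>e\<in>arcs G. x e + coboundary G \<phi> e \<ge> 0) \<and>
    grown_arborescence G v\<^sub>0 (verts G) T' \<and> (\<forall>e\<in>T'. x e + coboundary G \<phi> e = 0)"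
  using assms(3-)
proof (induction "card (verts G - R)" arbitrary: x R T rule: less_induct)
  case less
  interpret fin_digraph G using G by (simp add: eulerian_digraph_def)
  show ?case
  proof (cases "R = verts G")
    case True
    then show ?thesis
      using less.prems by (intro exI[of _ "\<lambda>_. 0"] exI[of _ T]) (auto simp: coboundary_def)
  next
    case False
    define L where "L = {e \<in> arcs G. tail G e \<in> R \<and> head G e \<notin> R}"
    have R: "R \<subset> verts G" using grown_arborescence_verts[OF less.prems(1) v0] False by auto
    have "R \<noteq> {}" using grown_arborescence_root[OF less.prems(1)] by auto
    then have "L \<noteq> {}" using eulerian_leaving_arc[OF G R] by (auto simp: L_def)
    moreover have "finite L" by (simp add: L_def)
    ultimately obtain f where f: "f \<in> L" and min: "\<And>e. e \<in> L \<Longrightarrow> x f \<le> x e"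
      using arg_min_if_finite[of L x] by (metis not_less)
    have f': "f \<in> arcs G" "tail G f \<in> R" "head G f \<notin> R" using f by (auto simp: L_def)
    let ?\<psi> = "\<lambda>v. if v \<in> R then 0 else - x f"
    let ?y = "\<lambda>e. x e + coboundary G ?\<psi> e"
    have y_nonneg: "?y e \<ge> 0" if "e \<in> arcs G" for e
      using less.prems(2)[OF that] less.prems(2)[OF f'(1)] min[of e] that
      by (auto simp: coboundary_def L_def)
    have "?y f = 0" using f' by (simp add: coboundary_def)
    then have y_zero: "?y e = 0" if "e \<in> insert f T" for e
      using that less.prems(3)[of e] grown_arborescence_ends[OF less.prems(1), of e]
      by (auto simp: coboundary_def)
    have card: "card (verts G - insert (head G f) R) < card (verts G - R)"
      using f' by (subst Diff_insert, intro card_Diff1_less) simp_all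
    have "\<exists>\<phi> T'. (\<forall>e\<in>arcs G. ?y e + coboundary G \<phi> e \<ge> 0) \<and>
        grown_arborescence G v\<^sub>0 (verts G) T' \<and> (\<forall>e\<in>T'. ?y e + coboundary G \<phi> e = 0)"
      using less.hyps[OF card grown_arborescence.grow[OF less.prems(1) f'], of ?y] y_nonneg y_zero by blast
    then obtain \<phi> T' where "\<forall>e\<in>arcs G. ?y e + coboundary G \<phi> e \<ge> 0"
      "grown_arborescence G v\<^sub>0 (verts G) T'" "\<forall>e\<in>T'. ?y e + coboundary G \<phi> e = 0" by blast
    then show ?thesis
      by (intro exI[of _ "\<lambda>v. ?\<psi> v + \<phi> v"] exI[of _ T']) (auto simp only: coboundary_add add.assoc)
  qed
qed

text \<open>
  The coboundary of \<open>\<phi>\<close> is nonnegative on \<open>T\<close>, where \<open>x\<close> vanishes, so \<open>\<phi>\<close> is smallest at the root.  It is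
  nonpositive on \<open>T'\<close>, so \<open>\<phi>\<close> is also largest at the root.  Hence \<open>\<phi>\<close> is constant.
\<close>

lemma nonneg_tight_unique:
  assumes T: "grown_arborescence G v\<^sub>0 (verts G) T" "\<And>e. e \<in> T \<Longrightarrow> x e = 0"
    and T': "grown_arborescence G v\<^sub>0 (verts G) T'" "\<And>e. e \<in> T' \<Longrightarrow> y e = 0"
    and nonneg: "\<And>e. e \<in> arcs G \<Longrightarrow> x e \<ge> 0" "\<And>e. e \<in> arcs G \<Longrightarrow> y e \<ge> 0"
    and diff: "\<And>e. e \<in> arcs G \<Longrightarrow> y e - x e = coboundary G \<phi> e"
    and G: "wf_digraph G" and e: "e \<in> arcs G"
  shows "x e = y e"
proof -
  interpret wf_digraph G by fact
  have "\<phi> v\<^sub>0 \<le> \<phi> v" if "v \<in> verts G" for v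
  proof (rule grown_arborescence_monotone[OF T(1) _ that])
    fix e assume "e \<in> T"
    moreover then have "e \<in> arcs G" using grown_arborescence_arcs[OF T(1)] by blast
    ultimately show "coboundary G \<phi> e \<ge> 0" using diff[of e] T(2)[of e] nonneg(2)[of e] by simp
  qed
  moreover have "- \<phi> v\<^sub>0 \<le> - \<phi> v" if "v \<in> verts G" for v
  proof (rule grown_arborescence_monotone[OF T'(1) _ that])
    fix e assume "e \<in> T'"
    moreover then have "e \<in> arcs G" using grown_arborescence_arcs[OF T'(1)] by blast
    ultimately show "coboundary G (\<lambda>v. - \<phi> v) e \<ge> 0"
      using diff[of e] T'(2)[of e] nonneg(1)[of e] by (simp add: coboundary_minus)
  qed
  ultimately have "\<phi> v = \<phi> v\<^sub>0" if "v \<in> verts G" for v using that by fastforce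
  then show ?thesis using diff[OF e] e by (simp add: coboundary_def)
qed

section \<open>The triangulation of the root polytope\<close>

locale eulerian_dual_representation = dual_representation G A
  for G :: "('v, 'e) pre_digraph" and A :: "'n::finite \<Rightarrow> 'e \<Rightarrow> int" +
  fixes v\<^sub>0 :: 'v
  assumes eulerian: "eulerian_digraph G" and root_vertex: "v\<^sub>0 \<in> verts G"
begin

abbreviation spanning_set :: "'e set \<Rightarrow> bool" where
  "spanning_set T \<equiv> grown_arborescence G v\<^sub>0 (verts G) T"

lemma complex_iff:
  "S \<in> branching_dual_complex G v\<^sub>0 \<longleftrightarrow> S \<subseteq> arcs G \<and> (\<exists>T. spanning_set T \<and> T \<inter> S = {})"
  using grown_arborescence_arcs[of G v\<^sub>0 "verts G"]
  by (fastforce simp: branching_dual_complex_def branching_bases_eq)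

lemma complex_complement: "spanning_set T \<Longrightarrow> arcs G - T \<in> branching_dual_complex G v\<^sub>0"
  by (auto simp: complex_iff)

lemma complex_subset:
  "S \<in> branching_dual_complex G v\<^sub>0 \<Longrightarrow> R \<subseteq> S \<Longrightarrow> R \<in> branching_dual_complex G v\<^sub>0"
  by (auto simp: complex_iff)

lemma combination_eqE:
  assumes "combination x = combination y"
  obtains \<phi> where "\<And>e. e \<in> arcs G \<Longrightarrow> y e - x e = coboundary G \<phi> e"
proof -
  have "combination (\<lambda>e. y e - x e) = 0" using assms by (simp add: combination_diff)
  then show thesis using relation_is_coboundary that by blast
qed

text \<open>
  The coefficient sum is a linear functional of the point, equal to \<open>1\<close> on every column.  Thus the columns
  lie on an affine hyperplane that misses the origin, and linear and affine dependence agree on them.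
\<close>

lemma combination_determines_weight:
  assumes "combination x = combination y"
  shows "sum x (arcs G) = sum y (arcs G)"
proof -
  obtain \<phi> where "\<And>e. e \<in> arcs G \<Longrightarrow> y e - x e = coboundary G \<phi> e"
    using combination_eqE[OF assms] by blast
  then have "(\<Sum>e\<in>arcs G. y e - x e) = 0"
    using eulerian_coboundary_sum[OF eulerian, of \<phi>] by simp
  then show ?thesis by (simp add: sum_subtractf)
qed

lemma combination_single: "e \<in> arcs G \<Longrightarrow> combination (\<lambda>f. if f = e then 1 else 0) = real_column A e"
  by (subst combination_supported[of "{e}"]) auto

lemma combination_shift: "combination (\<lambda>e. x e + coboundary G \<phi> e) = combination x"
  by (simp add: combination_add coboundary_relation)

text \<open>
  Coefficients are taken on all arcs and required to vanish outside \<open>S\<close>, so that representations with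
  different supports can be compared.
\<close>

lemma col_hull_iff:
  assumes S: "S \<subseteq> arcs G"
  shows "p \<in> col_hull A S \<longleftrightarrow> (\<exists>x. (\<forall>e\<in>arcs G. x e \<ge> 0) \<and> (\<forall>e\<in>arcs G - S. x e = 0) \<and>
    sum x (arcs G) = 1 \<and> combination x = p)" (is "_ \<longleftrightarrow> (\<exists>x. ?bary x p)")
proof
  let ?Q = "{p. \<exists>x. ?bary x p}"
  have "real_column A e \<in> ?Q" if "e \<in> S" for e
    using that S combination_single[of e]
    by (intro CollectI exI[of _ "\<lambda>f. if f = e then 1 else 0"]) auto
  moreover have "convex ?Q"
  proof (rule convexI)
    fix p q and u w :: real
    assume "p \<in> ?Q" "q \<in> ?Q" and uw: "0 \<le> u" "0 \<le> w" "u + w = 1"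
    then obtain x y where "?bary x p" "?bary y q" by blast
    with uw have "?bary (\<lambda>e. u * x e + w * y e) (u *\<^sub>R p + w *\<^sub>R q)"
      by (simp add: combination_add combination_scale sum.distrib flip: sum_distrib_left)
    then show "u *\<^sub>R p + w *\<^sub>R q \<in> ?Q"
      by (intro CollectI exI[of _ "\<lambda>e. u * x e + w * y e"])
  qed
  ultimately have "col_hull A S \<subseteq> ?Q" unfolding col_hull_def by (intro hull_minimal) auto
  then show "p \<in> col_hull A S \<Longrightarrow> \<exists>x. ?bary x p" by blast
next
  assume "\<exists>x. ?bary x p"
  then obtain x where x: "?bary x p" by blast
  have fin: "finite S" using S by (rule finite_subset) simp
  have "sum x S = 1" using x S sum.mono_neutral_right[of "arcs G" S x] by simp
  then have "(\<Sum>e\<in>S. x e *\<^sub>R real_column A e) \<in> col_hull A S"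
    unfolding col_hull_def using x S by (intro convex_sum[OF fin convex_convex_hull]) (auto intro: hull_inc)
  then show "p \<in> col_hull A S" using combination_supported[OF S, of x] x by simp
qed

text \<open>
  The heart of the embedding: a point has at most one representation with nonnegative coefficients
  supported on a face of the dual complex, even if the face is not prescribed.
\<close>

lemma barycentric_unique:
  assumes S: "S \<in> branching_dual_complex G v\<^sub>0" "\<forall>e\<in>arcs G - S. x e = 0" "\<forall>e\<in>arcs G. x e \<ge> 0"
    and S': "S' \<in> branching_dual_complex G v\<^sub>0" "\<forall>e\<in>arcs G - S'. y e = 0" "\<forall>e\<in>arcs G. y e \<ge> 0"
    and "combination x = combination y" and e: "e \<in> arcs G"
  shows "x e = y e"
proof -
  obtain T where T: "spanning_set T" "T \<inter> S = {}" using S(1) by (auto simp: complex_iff)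
  obtain T' where T': "spanning_set T'" "T' \<inter> S' = {}" using S'(1) by (auto simp: complex_iff)
  obtain \<phi> where \<phi>: "\<And>e. e \<in> arcs G \<Longrightarrow> y e - x e = coboundary G \<phi> e"
    using combination_eqE assms(7) by blast
  show ?thesis
  proof (rule nonneg_tight_unique[OF T(1) _ T'(1) _ _ _ \<phi> wf_digraph e])
    show "x f = 0" if "f \<in> T" for f
      using that S(2) T grown_arborescence_arcs[OF T(1)] by blast
    show "y f = 0" if "f \<in> T'" for f
      using that S'(2) T' grown_arborescence_arcs[OF T'(1)] by blast
  qed (use S(3) S'(3) in auto)
qed

text \<open>
  A relation supported on \<open>S\<close> is a coboundary that vanishes on a spanning arborescence, so its potential is
  constant.
\<close>

lemma complex_independent:
  assumes "S \<in> branching_dual_complex G v\<^sub>0"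
  shows "\<not> dependent_family (real_column A) S"
proof
  assume dep: "dependent_family (real_column A) S"
  obtain T where T: "spanning_set T" "T \<inter> S = {}" and S: "S \<subseteq> arcs G"
    using assms by (auto simp: complex_iff)
  have "finite S" using S by (rule finite_subset) simp
  then obtain l i where l: "(\<Sum>e\<in>S. l e *\<^sub>R real_column A e) = 0" and i: "i \<in> S" "l i \<noteq> 0"
    using dep unfolding dependent_family_iff[OF \<open>finite S\<close>] by blast
  define x where "x e = (if e \<in> S then l e else 0)" for e
  have "combination x = 0"
    using l by (subst combination_supported[OF S]) (auto simp: x_def)
  then obtain \<phi> where \<phi>: "\<And>e. e \<in> arcs G \<Longrightarrow> x e = coboundary G \<phi> e"
    using relation_is_coboundary by blast
  have 0: "coboundary G \<phi> e = 0" if "e \<in> T" for e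
  proof -
    have "e \<in> arcs G" "e \<notin> S" using that T(2) grown_arborescence_arcs[OF T(1)] by auto
    then show ?thesis using \<phi>[of e] by (simp add: x_def)
  qed
  have "\<phi> v = \<phi> v\<^sub>0" if "v \<in> verts G" for v
    using grown_arborescence_monotone[OF T(1) _ that, of \<phi>] 0
      grown_arborescence_monotone[OF T(1) _ that, of "\<lambda>v. - \<phi> v"]
    by (simp add: coboundary_minus order_antisym)
  then have "x i = 0" using \<phi>[of i] i S by (auto simp: coboundary_def)
  then show False using i by (simp add: x_def)
qed

lemma complex_affine_independent:
  assumes "S \<in> branching_dual_complex G v\<^sub>0"
  shows "affine_independent_family (real_column A) S"
  using complex_independent[OF assms] affine_dependent_imp_dependent
  by (auto simp: affine_independent_family_def dependent_family_def)

lemma col_hull_Int: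
  assumes S: "S \<in> branching_dual_complex G v\<^sub>0" and S': "S' \<in> branching_dual_complex G v\<^sub>0"
  shows "col_hull A S \<inter> col_hull A S' = col_hull A (S \<inter> S')"
proof
  show "col_hull A (S \<inter> S') \<subseteq> col_hull A S \<inter> col_hull A S'"
    unfolding col_hull_def by (intro Int_greatest hull_mono) auto
  show "col_hull A S \<inter> col_hull A S' \<subseteq> col_hull A (S \<inter> S')"
  proof
    fix p assume p: "p \<in> col_hull A S \<inter> col_hull A S'"
    have sub: "S \<subseteq> arcs G" "S' \<subseteq> arcs G" using S S' by (auto simp: complex_iff)
    obtain x where x: "\<forall>e\<in>arcs G. x e \<ge> 0" "\<forall>e\<in>arcs G - S. x e = 0" "sum x (arcs G) = 1" "combination x = p"
      using p col_hull_iff[OF sub(1)] by blast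
    obtain y where y: "\<forall>e\<in>arcs G. y e \<ge> 0" "\<forall>e\<in>arcs G - S'. y e = 0" "combination y = p"
      using p col_hull_iff[OF sub(2)] by blast
    have "x e = y e" if "e \<in> arcs G" for e
      using barycentric_unique[OF S x(2,1) S' y(2,1) _ that] x(4) y(3) by simp
    then have "\<forall>e\<in>arcs G - S \<inter> S'. x e = 0" using x(2) y(2) by auto
    moreover have "S \<inter> S' \<subseteq> arcs G" using sub by auto
    ultimately show "p \<in> col_hull A (S \<inter> S')" using x col_hull_iff by blast
  qed
qed

lemma arborescence_simplices_eq:
  "arborescence_simplices A G v\<^sub>0 = (\<lambda>T. col_hull A (arcs G - T)) ` {T. spanning_set T}"
proof (intro equalityI subsetI)
  fix \<Delta> assume "\<Delta> \<in> arborescence_simplices A G v\<^sub>0"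
  then obtain B F where B: "\<Delta> = col_hull A B" "B \<subseteq> arcs G"
    and F: "spanning_arborescence_in G v\<^sub>0 F" "arcs F = arcs G - B"
    by (auto simp: arborescence_simplices_def)
  have "B = arcs G - arcs F" using B F by auto
  then show "\<Delta> \<in> (\<lambda>T. col_hull A (arcs G - T)) ` {T. spanning_set T}"
    using spanning_arborescence_imp_grown[OF F(1)] B by blast
next
  fix \<Delta> assume "\<Delta> \<in> (\<lambda>T. col_hull A (arcs G - T)) ` {T. spanning_set T}"
  then obtain T where T: "\<Delta> = col_hull A (arcs G - T)" "spanning_set T" by blast
  have "arcs (G\<lparr>arcs := T\<rparr>) = arcs G - (arcs G - T)"
    using grown_arborescence_arcs[OF T(2)] by auto
  then show "\<Delta> \<in> arborescence_simplices A G v\<^sub>0"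
    unfolding arborescence_simplices_def
    using T grown_imp_spanning_arborescence[OF T(2)] by blast
qed

lemma arborescence_simplexE:
  assumes "\<Delta> \<in> arborescence_simplices A G v\<^sub>0"
  obtains T where "spanning_set T" "\<Delta> = col_hull A (arcs G - T)"
  using assms unfolding arborescence_simplices_eq by (elim imageE) simp

lemma arborescence_simplexI:
  "spanning_set T \<Longrightarrow> col_hull A (arcs G - T) \<in> arborescence_simplices A G v\<^sub>0"
  unfolding arborescence_simplices_eq by (intro imageI) simp

lemma face_of_col_hull_iff:
  assumes "S \<in> branching_dual_complex G v\<^sub>0"
  shows "K face_of col_hull A S \<longleftrightarrow> (\<exists>R\<subseteq>S. K = col_hull A R)"
  using complex_affine_independent[OF assms]
  by (auto simp: affine_independent_family_def col_hull_def face_of_convex_hull_affine_independent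
      subset_image_iff)

text \<open>
  Every column lies in the affine hull of the columns outside \<open>T\<close>: subtracting the coboundary that agrees with
  its coefficient vector on \<open>T\<close> moves the support off \<open>T\<close>, without changing the point or, the digraph being
  Eulerian, the coefficient sum.
\<close>

lemma aff_dim_arborescence_simplex:
  assumes T: "spanning_set T"
  shows "aff_dim (col_hull A (arcs G - T)) = aff_dim (root_polytope A (arcs G))"
proof -
  let ?B = "arcs G - T" and ?a = "real_column A"
  have inj: "inj_on ?a ?B"
    using complex_affine_independent[OF complex_complement[OF T]]
    by (simp add: affine_independent_family_def)
  have "?a e \<in> affine hull (?a ` ?B)" if e: "e \<in> arcs G" for e
  proof -
    let ?x = "\<lambda>f. if f = e then 1 else 0 :: real"
    obtain \<phi> where \<phi>: "\<forall>f\<in>T. coboundary G \<phi> f = - ?x f"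
      using grown_arborescence_potential[OF T, of "\<lambda>f. - ?x f"] by blast
    define y where "y f = ?x f + coboundary G \<phi> f" for f
    have y0: "y f = 0" if "f \<in> arcs G - ?B" for f using that \<phi> by (auto simp: y_def)
    have comb: "combination y = ?a e"
      unfolding y_def combination_shift by (rule combination_single[OF e])
    have "sum y (arcs G) = 1"
      using e eulerian_coboundary_sum[OF eulerian, of \<phi>] by (simp add: y_def sum.distrib)
    then have "sum y ?B = 1" using y0 sum.mono_neutral_right[of "arcs G" ?B y] by auto
    moreover have "(\<Sum>f\<in>?B. y f *\<^sub>R ?a f) = ?a e"
      using comb combination_supported[of ?B y] y0 by auto
    ultimately show ?thesis
      using inj unfolding affine_hull_finite[OF finite_imageI[OF finite_Diff[OF finite_arcs]]]
      by (intro CollectI exI[of _ "\<lambda>v. y (inv_into ?B ?a v)"]) (simp add: sum.reindex)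
  qed
  then have "affine hull (?a ` arcs G) \<subseteq> affine hull (?a ` ?B)"
    by (intro hull_minimal) auto
  moreover have "affine hull (?a ` ?B) \<subseteq> affine hull (?a ` arcs G)"
    by (intro hull_mono) auto
  ultimately have "affine hull (?a ` ?B) = affine hull (?a ` arcs G)" by blast
  then show ?thesis
    unfolding col_hull_def aff_dim_convex_hull by (rule aff_dim_affine_hull2)
qed

lemma arborescence_simplices_cover: "\<Union> (arborescence_simplices A G v\<^sub>0) = root_polytope A (arcs G)"
proof
  show "\<Union> (arborescence_simplices A G v\<^sub>0) \<subseteq> root_polytope A (arcs G)"
    unfolding arborescence_simplices_eq col_hull_def by (intro UN_least hull_mono image_mono Diff_subset)
  show "root_polytope A (arcs G) \<subseteq> \<Union> (arborescence_simplices A G v\<^sub>0)"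
  proof
    fix p assume "p \<in> root_polytope A (arcs G)"
    then obtain x where x: "\<forall>e\<in>arcs G. x e \<ge> 0" "sum x (arcs G) = 1" "combination x = p"
      using col_hull_iff[of "arcs G" p] by blast
    obtain \<phi> T where T: "spanning_set T"
      and y: "\<forall>e\<in>arcs G. x e + coboundary G \<phi> e \<ge> 0" "\<forall>e\<in>T. x e + coboundary G \<phi> e = 0"
      using extend_tight_arborescence[OF eulerian root_vertex grown_arborescence.root, of x] x(1) by blast
    let ?y = "\<lambda>e. x e + coboundary G \<phi> e"
    have "combination ?y = p" using x(3) by (simp add: combination_shift)
    moreover have "sum ?y (arcs G) = 1"
      using x(2) eulerian_coboundary_sum[OF eulerian, of \<phi>] by (simp add: sum.distrib)
    ultimately have "p \<in> col_hull A (arcs G - T)"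
      using y by (subst col_hull_iff) (auto intro!: exI[of _ ?y])
    then show "p \<in> \<Union> (arborescence_simplices A G v\<^sub>0)"
      using arborescence_simplexI[OF T] by blast
  qed
qed

lemma arborescence_simplices_Int_face:
  assumes "\<Delta> \<in> arborescence_simplices A G v\<^sub>0" "\<Delta>' \<in> arborescence_simplices A G v\<^sub>0"
  shows "\<Delta> \<inter> \<Delta>' face_of \<Delta>"
proof -
  obtain T where T: "spanning_set T" "\<Delta> = col_hull A (arcs G - T)"
    using assms(1) by (rule arborescence_simplexE)
  obtain T' where T': "spanning_set T'" "\<Delta>' = col_hull A (arcs G - T')"
    using assms(2) by (rule arborescence_simplexE)
  have "\<Delta> \<inter> \<Delta>' = col_hull A ((arcs G - T) \<inter> (arcs G - T'))"
    using col_hull_Int[OF complex_complement[OF T(1)] complex_complement[OF T'(1)]] T T' by simp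
  moreover have "col_hull A ((arcs G - T) \<inter> (arcs G - T')) face_of col_hull A (arcs G - T)"
    unfolding face_of_col_hull_iff[OF complex_complement[OF T(1)]]
    by (intro exI[of _ "(arcs G - T) \<inter> (arcs G - T')"]) simp
  ultimately show ?thesis using T(2) by simp
qed

text \<open>
  Two different simplices meet in a common face.  As they have the same dimension, this face is proper in
  both, and so it misses the relative interiors.
\<close>

lemma triangulation: "triangulation_of (root_polytope A (arcs G)) (arborescence_simplices A G v\<^sub>0)"
  unfolding triangulation_of_def
proof (intro conjI ballI)
  let ?\<T> = "arborescence_simplices A G v\<^sub>0"
  show "\<Union> ?\<T> = root_polytope A (arcs G)" by (rule arborescence_simplices_cover)
  show dim: "aff_dim \<Delta> = aff_dim (root_polytope A (arcs G))" if "\<Delta> \<in> ?\<T>" for \<Delta>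
    using that by (rule arborescence_simplexE) (simp add: aff_dim_arborescence_simplex)
  have "{T. spanning_set T} \<subseteq> Pow (arcs G)"
  proof
    fix T assume "T \<in> {T. spanning_set T}"
    then show "T \<in> Pow (arcs G)" using grown_arborescence_arcs[of G v\<^sub>0 "verts G" T] by simp
  qed
  then have "finite {T. spanning_set T}" by (rule finite_subset) simp
  then have "finite ?\<T>" by (simp add: arborescence_simplices_eq)
  moreover have "\<exists>n. n simplex \<Delta>" if "\<Delta> \<in> ?\<T>" for \<Delta>
  proof -
    obtain T where T: "spanning_set T" "\<Delta> = col_hull A (arcs G - T)"
      using \<open>\<Delta> \<in> ?\<T>\<close> by (rule arborescence_simplexE)
    then have "\<not> affine_dependent (real_column A ` (arcs G - T))"
      using complex_affine_independent[OF complex_complement] by (simp add: affine_independent_family_def)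
    then show ?thesis
      unfolding T(2) col_hull_def simplex_def
      by (intro exI[of _ "int (card (real_column A ` (arcs G - T))) - 1"] exI[of _ "real_column A ` (arcs G - T)"]) simp
  qed
  ultimately show "triangulation ?\<T>"
    unfolding triangulation_def using arborescence_simplices_Int_face by blast
  show "pairwise (\<lambda>\<Delta> \<Delta>'. rel_interior \<Delta> \<inter> rel_interior \<Delta>' = {}) ?\<T>"
  proof (rule pairwiseI)
    fix \<Delta> \<Delta>' assume \<Delta>: "\<Delta> \<in> ?\<T>" "\<Delta>' \<in> ?\<T>" "\<Delta> \<noteq> \<Delta>'"
    have face: "\<Delta> \<inter> \<Delta>' face_of \<Delta>" "\<Delta> \<inter> \<Delta>' face_of \<Delta>'"
      using arborescence_simplices_Int_face[OF \<Delta>(1,2)] arborescence_simplices_Int_face[OF \<Delta>(2,1)]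
      by (simp_all add: Int_commute)
    have convex: "convex \<Delta>'" using \<Delta>(2) by (rule arborescence_simplexE) (simp add: col_hull_def)
    have "\<Delta> \<inter> \<Delta>' \<noteq> \<Delta>"
    proof
      assume "\<Delta> \<inter> \<Delta>' = \<Delta>"
      then have "\<Delta> face_of \<Delta>'" using face(2) by simp
      then have "aff_dim \<Delta> < aff_dim \<Delta>'" using face_of_aff_dim_lt[OF convex] \<Delta>(3) by blast
      then show False using dim \<Delta>(1,2) by simp
    qed
    then have "\<Delta> \<inter> \<Delta>' \<inter> rel_interior \<Delta> = {}" using face(1) by (rule face_of_disjoint_rel_interior[rotated])
    then show "rel_interior \<Delta> \<inter> rel_interior \<Delta>' = {}"
      using rel_interior_subset[of \<Delta>] rel_interior_subset[of \<Delta>'] by blast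
  qed
qed

lemma embedding:
  "geometric_embedding A (branching_dual_complex G v\<^sub>0) (arborescence_simplices A G v\<^sub>0)"
  unfolding geometric_embedding_def
proof (intro conjI ballI)
  show "col_hull A ` branching_dual_complex G v\<^sub>0 = {K. \<exists>\<Delta>\<in>arborescence_simplices A G v\<^sub>0. K face_of \<Delta>}"
  proof (intro equalityI subsetI)
    fix K assume "K \<in> col_hull A ` branching_dual_complex G v\<^sub>0"
    then obtain S where S: "K = col_hull A S" "S \<in> branching_dual_complex G v\<^sub>0" by blast
    then obtain T where T: "spanning_set T" "S \<subseteq> arcs G - T"
      unfolding complex_iff by blast
    then have "K face_of col_hull A (arcs G - T)"
      using face_of_col_hull_iff[OF complex_complement[OF T(1)]] S by blast
    then show "K \<in> {K. \<exists>\<Delta>\<in>arborescence_simplices A G v\<^sub>0. K face_of \<Delta>}"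
      using arborescence_simplexI[OF T(1)] by blast
  next
    fix K assume "K \<in> {K. \<exists>\<Delta>\<in>arborescence_simplices A G v\<^sub>0. K face_of \<Delta>}"
    then obtain \<Delta> where "\<Delta> \<in> arborescence_simplices A G v\<^sub>0" "K face_of \<Delta>" by blast
    then obtain T where T: "spanning_set T" "K face_of col_hull A (arcs G - T)"
      by (metis arborescence_simplexE)
    then obtain S where "S \<subseteq> arcs G - T" "K = col_hull A S"
      using face_of_col_hull_iff[OF complex_complement[OF T(1)]] by blast
    then show "K \<in> col_hull A ` branching_dual_complex G v\<^sub>0"
      using complex_subset[OF complex_complement[OF T(1)]] by blast
  qed
qed (simp_all add: complex_affine_independent col_hull_Int)

end

theorem corollary4p7:
  fixes G :: "('v, 'e) pre_digraph" and v\<^sub>0 :: 'v and A :: "'n::finite \<Rightarrow> 'e \<Rightarrow> int"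
  assumes "eulerian_digraph G"
    and "v\<^sub>0 \<in> verts G"
    and "totally_unimodular A (arcs G)"
    and "represents_oriented_dual A G"
  shows "triangulation_of (root_polytope A (arcs G)) (arborescence_simplices A G v\<^sub>0) \<and>
         geometric_embedding A (branching_dual_complex G v\<^sub>0) (arborescence_simplices A G v\<^sub>0)"
proof -
  interpret fin_digraph G using assms(1) by (simp add: eulerian_digraph_def)
  interpret eulerian_dual_representation G A v\<^sub>0
    using assms by unfold_locales
  show ?thesis using triangulation embedding by blast
qed

end
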